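(* Let $k\ge 2$ be an integer and let $G$ be a connected finite simple graph with $\sigma_3 \ge t_{k+1}-2k+4$. Then $G$ has a dominating $k$-ended tree.
   Context: All graphs are finite, undirected, without loops or multiple edges. If the independence number of $G$ is at least 3, $\sigma_3$ denotes the minimum of $d(x)+d(y)+d(z)$ over all independent sets $\{x,y,z\}$ of three vertices; otherwise $\sigma_3=+\infty$. A leaf is a vertex of degree one; a tree is $k$-ended if it has at most $k$ leaves. For a positive integer $j$, $t_j$ denotes the order (number of vertices) of a largest $j$-ended tree in $G$ (with the paper's convention that a Hamilton cycle counts as a 1-ended tree, $t_1$ is the order of a longest cycle and $t_2$ the order of a longest path). A subgraph $T$ of $G$ is dominating if $V(G)\setminus V(T)$ is an independent set of vertices, i.e. $G-V(T)$ has no edges. *)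

theory Defs
  imports "HOL-Library.Extended_Real"
begin

text \<open>
  A graph is given by its vertex set and its set of edges, each edge being a two-element set
  of vertices. (The trees of the AFP entry Graph-Theory are not usable for graphs modelled as
  symmetric digraphs: there an edge together with its reverse already forms a cycle.)
\<close>

definition simple_graph :: "'a set \<Rightarrow> 'a set set \<Rightarrow> bool" where
  "simple_graph V E \<longleftrightarrow> finite V \<and> (\<forall>e\<in>E. e \<subseteq> V \<and> card e = 2)"

definition is_subgraph :: "'a set \<Rightarrow> 'a set set \<Rightarrow> 'a set \<Rightarrow> 'a set set \<Rightarrow> bool" where
  "is_subgraph W F V E \<longleftrightarrow> simple_graph W F \<and> W \<subseteq> V \<and> F \<subseteq> E"

definition degree :: "'a set set \<Rightarrow> 'a \<Rightarrow> nat" where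
  "degree E v = card {e \<in> E. v \<in> e}"

definition graph_connected :: "'a set \<Rightarrow> 'a set set \<Rightarrow> bool" where
  "graph_connected V E \<longleftrightarrow> V \<noteq> {} \<and> (\<forall>u\<in>V. \<forall>v\<in>V. (u, v) \<in> {(x, y). {x, y} \<in> E}\<^sup>*)"

definition graph_cycle :: "'a set set \<Rightarrow> 'a list \<Rightarrow> bool" where
  "graph_cycle E c \<longleftrightarrow> length c \<ge> 3 \<and> distinct c \<and>
     (\<forall>i<length c. {c ! i, c ! (Suc i mod length c)} \<in> E)"

definition is_tree :: "'a set \<Rightarrow> 'a set set \<Rightarrow> bool" where
  "is_tree W F \<longleftrightarrow> simple_graph W F \<and> graph_connected W F \<and> (\<nexists>c. graph_cycle F c)"

definition leaves :: "'a set \<Rightarrow> 'a set set \<Rightarrow> 'a set" where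
  "leaves W F = {v \<in> W. degree F v = 1}"

definition ended_tree :: "nat \<Rightarrow> 'a set \<Rightarrow> 'a set set \<Rightarrow> bool" where
  "ended_tree k W F \<longleftrightarrow> is_tree W F \<and> card (leaves W F) \<le> k"

text \<open>
  The order of a largest \<open>j\<close>-ended tree, meant for \<open>j \<ge> 2\<close>. The convention by which a cycle
  counts as a 1-ended tree only matters for \<open>j = 1\<close>, since deleting an edge of a cycle leaves
  a 2-ended tree on the same vertices; it is not built in here.
\<close>
definition tree_order :: "'a set \<Rightarrow> 'a set set \<Rightarrow> nat \<Rightarrow> nat" where
  "tree_order V E j = Max {card W |W F. is_subgraph W F V E \<and> ended_tree j W F}"

definition independent_set :: "'a set set \<Rightarrow> 'a set \<Rightarrow> bool" where
  "independent_set E S \<longleftrightarrow> (\<forall>x\<in>S. \<forall>y\<in>S. {x, y} \<notin> E)"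

text \<open>The infimum is a minimum over a finite set, or \<open>\<infinity>\<close> if there is no independent triple.\<close>
definition sigma3 :: "'a set \<Rightarrow> 'a set set \<Rightarrow> ereal" where
  "sigma3 V E = (INF S \<in> {S. S \<subseteq> V \<and> card S = 3 \<and> independent_set E S}.
     ereal (real (\<Sum>v\<in>S. degree E v)))"

definition dominating :: "'a set \<Rightarrow> 'a set set \<Rightarrow> 'a set \<Rightarrow> bool" where
  "dominating V E W \<longleftrightarrow> independent_set E (V - W)"

end

theory Submission
  imports Defs
begin

text \<open>
  Let \<open>T\<close> be a largest \<open>k\<close>-ended tree and suppose it is not dominating. Then some path \<open>Q\<close> with at
  least two vertices lies outside \<open>T\<close> and starts next to \<open>T\<close>; take it maximal, so that its last
  vertex \<open>y\<close> only has neighbours in \<open>T\<close> and \<open>Q\<close>. Attaching \<open>Q\<close> gives a \<open>(k+1)\<close>-ended tree, hence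
  \<open>t\<^bsub>k+1\<^esub> \<ge> |T| + |Q|\<close>, and any two leaves \<open>a\<close>, \<open>b\<close> of \<open>T\<close> form an independent triple with \<open>y\<close>.

  If \<open>a\<close> is adjacent in the graph to \<open>v\<close>, the edge from \<open>v\<close> towards \<open>a\<close> can be exchanged for
  \<open>av\<close>. By maximality of \<open>T\<close> the exchanged tree cannot have fewer leaves, cannot have \<open>Q\<close> attached
  at a leaf, and cannot have two adjacent leaves (these could be joined and the resulting cycle cut
  at a branch vertex). The same applies after deleting one more vertex, since \<open>Q\<close> makes up
  for it. This restricts the predecessors of the neighbours of \<open>a\<close> and \<open>b\<close> so much that suitable
  shifts of the neighbourhoods of \<open>a\<close>, \<open>b\<close>, \<open>y\<close> become disjoint subsets of \<open>T\<close> which also avoid the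
  other \<open>k - 2\<close> leaves and their tree neighbours. Counting gives
  \<open>d(a) + d(b) + d(y) \<le> |T| + |Q| - 2k + 3\<close>, against the assumption on \<open>\<sigma>\<^sub>3\<close>.
\<close>

section \<open>Degrees\<close>

lemma degree_insert:
  assumes "finite F" "e \<notin> F"
  shows "degree (insert e F) v = degree F v + (if v \<in> e then 1 else 0)"
proof -
  have "{f \<in> insert e F. v \<in> f} = (if v \<in> e then insert e {f \<in> F. v \<in> f} else {f \<in> F. v \<in> f})"
    by auto
  then show ?thesis
    using assms by (simp add: degree_def)
qed

lemma degree_remove:
  assumes "finite F" "e \<in> F"
  shows "degree (F - {e}) v + (if v \<in> e then 1 else 0) = degree F v"
  using degree_insert[of "F - {e}" e v] assms by (simp add: insert_absorb)

lemma card_le_degree: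
  assumes "finite F" "S \<subseteq> F" "\<And>e. e \<in> S \<Longrightarrow> v \<in> e"
  shows "card S \<le> degree F v"
  unfolding degree_def using assms by (intro card_mono) auto

lemma simple_graph_edgeD:
  assumes "simple_graph V E" "{a, b} \<in> E"
  shows "a \<in> V" "b \<in> V" "a \<noteq> b"
proof -
  have "{a, b} \<subseteq> V" "card {a, b} = 2"
    using assms unfolding simple_graph_def by blast+
  then show "a \<in> V" "b \<in> V" "a \<noteq> b" by auto
qed

lemma degree_eq_card_neighbours:
  assumes "simple_graph V E"
  shows "degree E v = card {u. {v, u} \<in> E}"
proof -
  have "{e \<in> E. v \<in> e} = (\<lambda>u. {v, u}) ` {u. {v, u} \<in> E}"
  proof (intro equalityI subsetI)
    fix e assume e: "e \<in> {e \<in> E. v \<in> e}"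
    then have "card e = 2" using assms unfolding simple_graph_def by blast
    then obtain a b where "e = {a, b}" by (meson card_2_iff)
    with e show "e \<in> (\<lambda>u. {v, u}) ` {u. {v, u} \<in> E}"
      by (auto simp: insert_commute)
  qed auto
  moreover have "inj_on (\<lambda>u. {v, u}) {u. {v, u} \<in> E}"
    by (auto simp: inj_on_def doubleton_eq_iff)
  ultimately show ?thesis
    unfolding degree_def by (simp add: card_image)
qed

section \<open>Trees as parent functions\<close>

text \<open>The height \<open>h\<close> is only required to drop strictly along \<open>p\<close>; it is not the distance
  to the root, so that heights need not be recomputed when subtrees are moved.\<close>

definition rooted :: "'a \<Rightarrow> ('a \<Rightarrow> 'a) \<Rightarrow> ('a \<Rightarrow> nat) \<Rightarrow> 'a set \<Rightarrow> 'a set set \<Rightarrow> bool" where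
  "rooted r p h W F \<longleftrightarrow> finite W \<and> r \<in> W \<and> (\<forall>v\<in>W - {r}. p v \<in> W \<and> h (p v) < h v) \<and>
     F = (\<lambda>v. {v, p v}) ` (W - {r})"

text \<open>Maximality is later taken among trees of this kind; \<open>tree_is_tree\<close> carries
  the outcome over to \<open>is_tree\<close>.\<close>

definition tree :: "'a set \<Rightarrow> 'a set set \<Rightarrow> bool" where
  "tree W F \<longleftrightarrow> (\<exists>r p h. rooted r p h W F)"

text \<open>The vertex set of the tree path from \<open>s\<close> up to the root. The walk has to
  stop at \<open>r\<close>, since \<open>rooted\<close> leaves \<open>p r\<close>
  unconstrained.\<close>

inductive_set ancestors :: "('a \<Rightarrow> 'a) \<Rightarrow> 'a \<Rightarrow> 'a \<Rightarrow> 'a set" for p r s where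
  self: "s \<in> ancestors p r s"
| parent: "v \<in> ancestors p r s \<Longrightarrow> v \<noteq> r \<Longrightarrow> p v \<in> ancestors p r s"

lemma rootedD:
  assumes "rooted r p h W F"
  shows "finite W" "r \<in> W" "finite F" "F = (\<lambda>v. {v, p v}) ` (W - {r})"
  using assms unfolding rooted_def by auto

lemma rooted_parent:
  assumes "rooted r p h W F" "v \<in> W" "v \<noteq> r"
  shows "p v \<in> W" "h (p v) < h v" "p v \<noteq> v" "{v, p v} \<in> F"
proof -
  show "p v \<in> W" "h (p v) < h v" "{v, p v} \<in> F"
    using assms unfolding rooted_def by auto
  then show "p v \<noteq> v" by auto
qed

lemma rooted_edge:
  assumes "rooted r p h W F" "{a, b} \<in> F"
  shows "a \<in> W \<and> a \<noteq> r \<and> p a = b \<or> b \<in> W \<and> b \<noteq> r \<and> p b = a"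
  using assms unfolding rooted_def by (auto simp: doubleton_eq_iff)

lemma rooted_induct [consumes 2, case_names root step]:
  assumes "rooted r p h W F" "v \<in> W"
    and "P r" "\<And>v. v \<in> W \<Longrightarrow> v \<noteq> r \<Longrightarrow> P (p v) \<Longrightarrow> P v"
  shows "P v"
  using assms(2)
proof (induction "h v" arbitrary: v rule: less_induct)
  case less
  then show ?case
    using assms rooted_parent(1,2)[OF assms(1)] by (cases "v = r") auto
qed

lemma rooted_height_pos:
  assumes "rooted r p h W F" "v \<in> W" "v \<noteq> r"
  shows "h r < h v"
proof -
  have "v \<noteq> r \<longrightarrow> h r < h v"
    using assms(1,2)
  proof (induction rule: rooted_induct)
    case (step v)
    then show ?case using rooted_parent(2)[OF assms(1), of v] by (cases "p v = r") auto
  qed simp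
  with assms show ?thesis by simp
qed

text \<open>Following parents connects every vertex to the root. On a cycle, a vertex of maximal
  height would have both of its cycle neighbours as its parent, but these are distinct.\<close>

lemma rooted_is_tree:
  assumes "rooted r p h W F"
  shows "is_tree W F"
  unfolding is_tree_def
proof (intro conjI)
  show "simple_graph W F"
    unfolding simple_graph_def rootedD(4)[OF assms]
    using rootedD(1)[OF assms] rooted_parent(1)[OF assms] rooted_parent(3)[OF assms, THEN not_sym]
    by (auto simp: card_insert_if)
  have root: "(v, r) \<in> {(x, y). {x, y} \<in> F}\<^sup>*" if "v \<in> W" for v
    using assms that
  proof (induction rule: rooted_induct)
    case (step v)
    then show ?case
      using rooted_parent(4)[OF assms, of v] by (blast intro: converse_rtrancl_into_rtrancl)
  qed simp
  have "sym ({(x, y). {x, y} \<in> F}\<^sup>*)"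
    by (intro sym_rtrancl symI) (auto simp: insert_commute)
  then have "(r, v) \<in> {(x, y). {x, y} \<in> F}\<^sup>*" if "v \<in> W" for v
    using root[OF that] by (rule symD)
  with root show "graph_connected W F"
    unfolding graph_connected_def using rootedD(2)[OF assms] by (blast intro: rtrancl_trans)
  show "\<nexists>c. graph_cycle F c"
  proof
    assume "\<exists>c. graph_cycle F c"
    then obtain c where c: "length c \<ge> 3" "distinct c"
      and E: "\<And>i. i < length c \<Longrightarrow> {c ! i, c ! (Suc i mod length c)} \<in> F"
      unfolding graph_cycle_def by auto
    let ?n = "length c"
    have ne: "(\<lambda>i. h (c ! i)) ` {..<?n} \<noteq> {}" using c(1) by (auto simp: lessThan_empty_iff)
    obtain i where i: "i < ?n" and mx: "\<And>j. j < ?n \<Longrightarrow> h (c ! j) \<le> h (c ! i)"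
    proof -
      have "Max ((\<lambda>i. h (c ! i)) ` {..<?n}) \<in> (\<lambda>i. h (c ! i)) ` {..<?n}"
        using ne by (intro Max_in) auto
      then obtain i where "i < ?n" "h (c ! i) = Max ((\<lambda>i. h (c ! i)) ` {..<?n})" by auto
      then show thesis using that[of i] by simp
    qed
    have par: "p (c ! i) = c ! j" if "j < ?n" "{c ! i, c ! j} \<in> F" for j
      using rooted_edge[OF assms that(2)] mx[OF that(1)] rooted_parent(2)[OF assms, of "c ! j"]
      by auto
    let ?s = "Suc i mod ?n"
    have s: "?s < ?n" using i by (intro mod_less_divisor) linarith
    have s_eq: "?s = (if Suc i = ?n then 0 else Suc i)" using i by auto
    obtain j where j: "j < ?n" "Suc j mod ?n = i" "j = (if i = 0 then ?n - 1 else i - 1)"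
      using i c(1) by (cases i) auto
    have "p (c ! i) = c ! ?s" using par[OF s E[OF i]] .
    moreover have "{c ! i, c ! j} \<in> F"
      using E[OF j(1)] by (simp add: j(2) insert_commute)
    then have "p (c ! i) = c ! j" by (rule par[OF j(1)])
    ultimately have "c ! ?s = c ! j" by simp
    then have "?s = j" using nth_eq_iff_index_eq[OF c(2) s j(1)] by blast
    then show False using s_eq j(3) c(1) i by (auto split: if_splits)
  qed
qed

lemma tree_is_tree: "tree W F \<Longrightarrow> is_tree W F"
  unfolding tree_def by (auto dest: rooted_is_tree)

lemma ancestors_subset:
  assumes "rooted r p h W F" "s \<in> W"
  shows "ancestors p r s \<subseteq> W"
proof
  fix v assume "v \<in> ancestors p r s"
  then show "v \<in> W"
    by induction (use assms rooted_parent(1)[OF assms(1)] in auto)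
qed

lemma ancestors_height:
  assumes "rooted r p h W F" "s \<in> W" "v \<in> ancestors p r s"
  shows "h v \<le> h s"
  using assms(3)
proof induction
  case (parent v)
  then show ?case
    using rooted_parent(2)[OF assms(1), of v] ancestors_subset[OF assms(1,2)] by fastforce
qed simp

text \<open>The introduction rules extend the path at its upper end; this peels off the lower end,
  as inductions along parents require.\<close>

lemma ancestors_unfold:
  "ancestors p r s = insert s (if s = r then {} else ancestors p r (p s))"
proof (intro equalityI subsetI)
  fix v assume "v \<in> ancestors p r s"
  then show "v \<in> insert s (if s = r then {} else ancestors p r (p s))"
  proof induction
    case self
    show ?case by simp
  next
    case (parent v)
    show ?case
    proof (cases "v = s")
      case True
      then show ?thesis using parent.hyps ancestors.self[of "p s" p r] by simp
    next
      case False
      then have "s \<noteq> r" "v \<in> ancestors p r (p s)" using parent.IH by (simp_all split: if_splits)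
      then show ?thesis using ancestors.parent[of v p r "p s"] parent.hyps by simp
    qed
  qed
next
  fix v assume v: "v \<in> insert s (if s = r then {} else ancestors p r (p s))"
  have "u \<in> ancestors p r s" if "u \<in> ancestors p r (p s)" "s \<noteq> r" for u
    using that(1)
  proof induction
    case self
    show ?case using ancestors.parent[OF ancestors.self, of s r p] that(2) by simp
  next
    case (parent u)
    show ?case using ancestors.parent[OF parent.IH parent.hyps(2)] .
  qed
  with v show "v \<in> ancestors p r s"
    using ancestors.self[of s p r] by (cases "v = s") (simp_all split: if_splits)
qed

lemma ancestors_child:
  assumes "v \<in> ancestors p r s" "v \<noteq> s"
  shows "\<exists>u\<in>ancestors p r s. u \<noteq> r \<and> p u = v"
  using assms(1)
proof cases
  case self
  with assms(2) show ?thesis by simp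
next
  case (parent u)
  then show ?thesis by (intro bexI[of _ u]) simp_all
qed

lemma root_in_ancestors:
  assumes "rooted r p h W F" "s \<in> W"
  shows "r \<in> ancestors p r s"
  using assms
proof (induction rule: rooted_induct)
  case root show ?case by (rule ancestors.self)
next
  case (step v) then show ?case by (subst ancestors_unfold) simp
qed

lemma ancestors_linear:
  assumes "u \<in> ancestors p r s" "v \<in> ancestors p r s"
  shows "u \<in> ancestors p r v \<or> v \<in> ancestors p r u"
  using assms
proof (induction)
  case self
  then show ?case by simp
next
  case (parent u)
  then show ?case
    using ancestors_unfold[of p r u] ancestors.parent[of u p r v] ancestors.self by auto
qed

text \<open>Of two vertices on the path one is an ancestor of the other. If they were distinct with
  a common parent, it would be an ancestor of its own parent, against the heights.\<close>

lemma ancestors_parent_inj: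
  assumes "rooted r p h W F" "s \<in> W" "u \<in> ancestors p r s" "v \<in> ancestors p r s"
    and "u \<noteq> r" "v \<noteq> r" "p u = p v"
  shows "u = v"
proof -
  have *: "a = b" if "a \<in> W" "b \<in> W" "a \<in> ancestors p r b" "p a = p b" "a \<noteq> r" "b \<noteq> r" for a b
  proof (rule ccontr)
    assume "a \<noteq> b"
    with that have "a \<in> ancestors p r (p a)" using ancestors_unfold[of p r b] by simp
    then have "h a \<le> h (p a)"
      using ancestors_height[OF assms(1)] rooted_parent(1)[OF assms(1) that(1,5)] by blast
    then show False using rooted_parent(2)[OF assms(1) that(1,5)] by simp
  qed
  have "u \<in> W" "v \<in> W" using assms(3,4) ancestors_subset[OF assms(1,2)] by auto
  then show ?thesis using *[of u v] *[of v u] ancestors_linear[OF assms(3,4)] assms(5-7) by auto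
qed

text \<open>The parent pointers on the path from \<open>s\<close> to \<open>r\<close> are reversed
  and all others are kept; the edge set does not change.\<close>

lemma reroot:
  assumes R: "rooted r p h W F" and s: "s \<in> W"
  obtains q g where "rooted s q g W F"
    and "\<And>v. v \<notin> ancestors p r s \<Longrightarrow> q v = p v"
    and "\<And>v. v \<in> ancestors p r s \<Longrightarrow> v \<noteq> r \<Longrightarrow> q (p v) = v"
proof -
  define P where "P = ancestors p r s"
  \<comment> \<open>On the path the new parent is the old child on the path, unique by
    \<open>ancestors_parent_inj\<close>. The new root \<open>s\<close> has no such child, and the
    value of \<open>q\<close> there is arbitrary.\<close>
  define q where "q v = (if v \<in> P then (THE u. u \<in> P \<and> u \<noteq> r \<and> p u = v) else p v)" for v
  \<comment> \<open>Heights are reversed along the path, and all other vertices are lifted above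
    \<open>h s\<close>, hence above the whole path.\<close>
  define g where "g v = (if v \<in> P then h s - h v else h s + 1 + h v)" for v
  have PW: "P \<subseteq> W" unfolding P_def by (rule ancestors_subset[OF R s])
  have sP: "s \<in> P" unfolding P_def by (rule ancestors.self)
  have rP: "r \<in> P" unfolding P_def by (rule root_in_ancestors[OF R s])
  have hP: "h v \<le> h s" if "v \<in> P" for v
    using that ancestors_height[OF R s] unfolding P_def by blast
  have pP: "p v \<in> P" if "v \<in> P" "v \<noteq> r" for v
    using that unfolding P_def by (rule ancestors.parent)
  have qp: "q (p v) = v" if "v \<in> P" "v \<noteq> r" for v
    unfolding q_def using pP[OF that] that ancestors_parent_inj[OF R s] 
    by (auto simp: P_def intro!: the_equality)
  have child: "\<exists>u\<in>P. u \<noteq> r \<and> p u = v" if "v \<in> P" "v \<noteq> s" for v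
    using that ancestors_child unfolding P_def by fast
  have up: "q v \<in> W \<and> g (q v) < g v" if v: "v \<in> W" "v \<noteq> s" for v
  proof (cases "v \<in> P")
    case True
    then obtain u where u: "u \<in> P" "u \<noteq> r" "p u = v" using child v by blast
    then have "q v = u" using qp by blast
    moreover have "h v < h u" using rooted_parent(2)[OF R, of u] u PW by blast
    ultimately show ?thesis using u(1) True hP[OF u(1)] PW by (auto simp: g_def)
  next
    case False
    then have "v \<noteq> r" using rP by blast
    then show ?thesis
      using rooted_parent[OF R v(1)] False by (auto simp: q_def g_def)
  qed
  have edges: "(\<lambda>v. {v, q v}) ` (W - {s}) = (\<lambda>v. {v, p v}) ` (W - {r})"
  proof (intro equalityI subsetI)
    fix e assume "e \<in> (\<lambda>v. {v, q v}) ` (W - {s})"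
    then obtain v where v: "v \<in> W" "v \<noteq> s" "e = {v, q v}" by blast
    show "e \<in> (\<lambda>v. {v, p v}) ` (W - {r})"
    proof (cases "v \<in> P")
      case True
      then obtain u where u: "u \<in> P" "u \<noteq> r" "p u = v" using child v by blast
      then have "q v = u" using qp by blast
      then show ?thesis using u v PW by (auto simp: insert_commute intro!: image_eqI[of _ _ u])
    next
      case False
      then show ?thesis using v rP by (auto simp: q_def)
    qed
  next
    fix e assume "e \<in> (\<lambda>v. {v, p v}) ` (W - {r})"
    then obtain v where v: "v \<in> W" "v \<noteq> r" "e = {v, p v}" by blast
    show "e \<in> (\<lambda>v. {v, q v}) ` (W - {s})"
    proof (cases "v \<in> P")
      case True
      have "p v \<noteq> s" using hP[OF True] rooted_parent(2)[OF R v(1,2)] by auto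
      then show ?thesis
        using qp[OF True v(2)] rooted_parent(1)[OF R v(1,2)] v(3)
        by (auto simp: insert_commute intro!: image_eqI[of _ _ "p v"])
    next
      case False
      then show ?thesis using v sP by (auto simp: q_def intro!: image_eqI[of _ _ v])
    qed
  qed
  have "rooted s q g W F"
    using up edges s rootedD[OF R] by (auto simp: rooted_def)
  then show thesis
    using that qp by (auto simp: q_def P_def)
qed

lemma tree_root:
  assumes "tree W F" "s \<in> W"
  obtains p h where "rooted s p h W F"
  using assms reroot unfolding tree_def by metis

text \<open>The second tree is hung below \<open>a\<close> by its root; its heights are raised above
  \<open>h a\<close> to allow this.\<close>

lemma rooted_join:
  assumes R: "rooted r p h W F" and S: "rooted s q g X D" and dis: "W \<inter> X = {}" and a: "a \<in> W"
  shows "tree (W \<union> X) (insert {s, a} (F \<union> D))"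
proof -
  let ?p = "\<lambda>v. if v \<in> X then (if v = s then a else q v) else p v"
  let ?h = "\<lambda>v. if v \<in> X then h a + 1 + g v else h v"
  have s: "s \<in> X" "s \<notin> W" "r \<in> W" "r \<notin> X"
    using R S dis by (auto simp: rooted_def)
  have "(\<lambda>v. {v, ?p v}) ` (W \<union> X - {r}) =
      (\<lambda>v. {v, ?p v}) ` (W - {r}) \<union> (\<lambda>v. {v, ?p v}) ` (X - {s}) \<union> (\<lambda>v. {v, ?p v}) ` {s}"
    using s by auto
  also have "(\<lambda>v. {v, ?p v}) ` (W - {r}) = (\<lambda>v. {v, p v}) ` (W - {r})"
    using dis by (intro image_cong) auto
  also have "\<dots> = F" using R by (simp add: rooted_def)
  also have "(\<lambda>v. {v, ?p v}) ` (X - {s}) = (\<lambda>v. {v, q v}) ` (X - {s})"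
    by (intro image_cong) auto
  also have "\<dots> = D" using S by (simp add: rooted_def)
  also have "(\<lambda>v. {v, ?p v}) ` {s} = {{s, a}}" using s by simp
  finally have edges: "(\<lambda>v. {v, ?p v}) ` (W \<union> X - {r}) = insert {s, a} (F \<union> D)" by simp
  have up: "?p v \<in> W \<union> X \<and> ?h (?p v) < ?h v" if "v \<in> W \<union> X" "v \<noteq> r" for v
  proof (cases "v \<in> X")
    case True
    then show ?thesis
      using rooted_parent(1,2)[OF S, of v] a dis by (cases "v = s") auto
  next
    case False
    then show ?thesis
      using rooted_parent(1,2)[OF R, of v] that dis by auto
  qed
  have "rooted r ?p ?h (W \<union> X) (insert {s, a} (F \<union> D))"
    unfolding rooted_def edges using up rootedD(1,2)[OF R] rootedD(1)[OF S] by simp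
  then show ?thesis unfolding tree_def by blast
qed

text \<open>\<open>X\<close> is the subtree below \<open>c\<close>. Both pieces inherit
  \<open>p\<close> and \<open>h\<close> unchanged.\<close>

lemma rooted_split:
  assumes R: "rooted r p h W F" and c: "c \<in> W" "c \<noteq> r"
  defines "X \<equiv> {v \<in> W. c \<in> ancestors p r v}"
  obtains F1 F2 where "rooted r p h (W - X) F1" "rooted c p h X F2" "F1 \<union> F2 = F - {{c, p c}}"
proof
  have X: "p v \<in> X" if "v \<in> X" "v \<noteq> c" for v
  proof -
    have "v \<noteq> r" using that ancestors_unfold[of p r v] by (auto simp: X_def split: if_splits)
    with that show ?thesis
      using ancestors_unfold[of p r v] rooted_parent(1)[OF R] by (auto simp: X_def)
  qed
  have W: "p v \<in> W - X" if "v \<in> W - X" "v \<noteq> r" for v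
    using that ancestors_unfold[of p r v] rooted_parent(1)[OF R] by (auto simp: X_def)
  have r: "r \<notin> X" using c ancestors_unfold[of p r r] by (auto simp: X_def)
  have cX: "c \<in> X" using c by (auto simp: X_def intro: ancestors.self)
  have XW: "X \<subseteq> W" by (auto simp: X_def)
  show "rooted r p h (W - X) ((\<lambda>v. {v, p v}) ` (W - X - {r}))"
    using R W r unfolding rooted_def by auto
  show "rooted c p h X ((\<lambda>v. {v, p v}) ` (X - {c}))"
    using R X r cX XW unfolding rooted_def by (auto intro: finite_subset)
  have "{v, p v} \<noteq> {c, p c}" if "v \<in> W" "v \<noteq> r" "v \<noteq> c" for v
    using rooted_parent(2)[OF R that(1,2)] rooted_parent(2)[OF R c] that
    by (auto simp: doubleton_eq_iff)
  then show "(\<lambda>v. {v, p v}) ` (W - X - {r}) \<union> (\<lambda>v. {v, p v}) ` (X - {c}) = F - {{c, p c}}"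
    unfolding rootedD(4)[OF R] using r cX XW by auto
qed

text \<open>The edge above \<open>c\<close> separates \<open>b\<close> from \<open>a\<close>. After
  cutting it, the part below is rerooted at \<open>b\<close> and hung on \<open>a\<close>.\<close>

lemma tree_exchange:
  assumes R: "rooted r p h W F" and c: "c \<in> ancestors p r b" "c \<noteq> r" "b \<in> W"
    and a: "a \<in> W" "c \<notin> ancestors p r a"
  shows "tree W (insert {b, a} (F - {{c, p c}}))"
proof -
  let ?X = "{v \<in> W. c \<in> ancestors p r v}"
  have cW: "c \<in> W" using c ancestors_subset[OF R] by blast
  obtain F1 F2 where F1: "rooted r p h (W - ?X) F1" and F2: "rooted c p h ?X F2"
    and F: "F1 \<union> F2 = F - {{c, p c}}"
    using rooted_split[OF R cW c(2)] by blast
  have "b \<in> ?X" using c by simp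
  then obtain q g where "rooted b q g ?X F2"
    by (rule reroot[OF F2]) (rule that)
  from rooted_join[OF F1 this] a have "tree (W - ?X \<union> ?X) (insert {b, a} (F1 \<union> F2))" by auto
  moreover have "W - ?X \<union> ?X = W" by auto
  ultimately show ?thesis by (simp only: F)
qed

text \<open>A vertex other than the root spends one edge on its parent, so degree 2 leaves room for
  a single child, as does degree 1 at the root.\<close>

lemma child_edges:
  assumes "rooted r p h W F" "v \<in> W" "v \<noteq> r" "v' \<in> W" "v' \<noteq> r" "p v = u" "p v' = u"
    and "degree F u \<le> (if u = r then 1 else 2)"
  shows "v = v'"
proof (rule ccontr)
  assume ne: "v \<noteq> v'"
  have uW: "u \<in> W" using rooted_parent(1)[OF assms(1,2,3)] assms(6) by simp
  have h: "h u < h v" "h u < h v'"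
    using rooted_parent(2)[OF assms(1,2,3)] rooted_parent(2)[OF assms(1,4,5)] assms(6,7) by simp_all
  have F: "{v, u} \<in> F" "{v', u} \<in> F"
    using rooted_parent(4)[OF assms(1,2,3)] rooted_parent(4)[OF assms(1,4,5)] assms(6,7) by simp_all
  have ne2: "{v, u} \<noteq> {v', u}" using ne by (auto simp: doubleton_eq_iff)
  show False
  proof (cases "u = r")
    case True
    have "card {{v, u}, {v', u}} \<le> degree F u"
      using F rootedD(3)[OF assms(1)] by (intro card_le_degree) auto
    with True ne2 assms(8) show False by simp
  next
    case False
    note pu = rooted_parent[OF assms(1) uW False]
    have "{u, p u} \<noteq> {v, u}" "{u, p u} \<noteq> {v', u}"
      using pu(2) h by (auto simp: doubleton_eq_iff)
    with ne2 have "card {{u, p u}, {v, u}, {v', u}} = 3" by simp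
    moreover have "card {{u, p u}, {v, u}, {v', u}} \<le> degree F u"
      using F pu(4) rootedD(3)[OF assms(1)] by (intro card_le_degree) auto
    ultimately show False using False assms(8) by simp
  qed
qed

lemma degree_pos_of_parent:
  assumes "rooted r p h W F" "v \<in> W" "v \<noteq> r"
  shows "1 \<le> degree F v"
  using card_le_degree[of F "{{v, p v}}" v] rooted_parent(4)[OF assms] rootedD(3)[OF assms(1)] by simp

text \<open>Mostly used in the form that a leaf other than the root is nobody's parent.\<close>

lemma degree_ge_2_of_child:
  assumes "rooted r p h W F" "v \<in> W" "v \<noteq> r" "p v \<noteq> r"
  shows "2 \<le> degree F (p v)"
proof -
  note v = rooted_parent[OF assms(1-3)]
  note u = rooted_parent[OF assms(1) v(1) assms(4)]
  have "{v, p v} \<noteq> {p v, p (p v)}" using u(2) v(2) by (auto simp: doubleton_eq_iff)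
  then show ?thesis
    using card_le_degree[of F "{{v, p v}, {p v, p (p v)}}" "p v"] u(4) v(4) rootedD(3)[OF assms(1)]
    by (auto simp: numeral_2_eq_2)
qed

text \<open>Rooted at some other vertex, the tree gives \<open>v\<close> a parent edge.\<close>

lemma degree_pos:
  assumes "tree W F" "v \<in> W" "2 \<le> card W"
  shows "1 \<le> degree F v"
proof -
  have "\<not> W \<subseteq> {v}" using assms card_mono[of "{v}" W] by force
  then obtain s where "s \<in> W" "s \<noteq> v" by blast
  with tree_root[OF assms(1)] degree_pos_of_parent assms(2) show ?thesis by metis
qed

lemma tree_finite: "tree W F \<Longrightarrow> finite W" "tree W F \<Longrightarrow> finite F"
  unfolding tree_def by (auto dest: rootedD)

lemma tree_edge_subset: "tree W F \<Longrightarrow> e \<in> F \<Longrightarrow> e \<subseteq> W"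
  unfolding tree_def rooted_def by auto

lemma leaves_subset: "leaves W F \<subseteq> W"
  by (auto simp: leaves_def)

lemma tree_finite_leaves: "tree W F \<Longrightarrow> finite (leaves W F)"
  using tree_finite(1) leaves_subset finite_subset by metis

section \<open>Changing trees\<close>

lemma tree_singleton: "tree {v} {}"
  unfolding tree_def rooted_def by auto

lemma tree_attach:
  assumes "tree W F" "w \<in> W" "u \<notin> W"
  shows "tree (insert u W) (insert {u, w} F)"
proof -
  obtain r p h where R: "rooted r p h W F" using assms unfolding tree_def by blast
  have "rooted u id (\<lambda>_. 0) {u} {}" unfolding rooted_def by simp
  from rooted_join[OF R this] assms show ?thesis by (simp add: Un_commute)
qed

text \<open>With two vertices present, \<open>w\<close> already has an edge and so cannot be a leaf
  afterwards; attached to a single vertex, \<open>u\<close> would make \<open>w\<close> a leaf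
  too.\<close>

lemma leaves_attach:
  assumes T: "tree W F" "w \<in> W" "u \<notin> W" "2 \<le> card W"
  shows "leaves (insert u W) (insert {u, w} F) = insert u (leaves W F - {w})"
proof -
  have "{u, w} \<notin> F" using tree_edge_subset[OF T(1)] T(3) by blast
  note deg = degree_insert[OF tree_finite(2)[OF T(1)] this]
  have "degree F u = 0"
    using tree_edge_subset[OF T(1)] T(3) unfolding degree_def by (auto simp: card_eq_0_iff)
  then show ?thesis
    unfolding leaves_def using deg degree_pos[OF T(1,2,4)] T(2,3) by auto
qed

text \<open>Each vertex of the path replaces its forerunner as a leaf, so only the last one remains
  as a new leaf.\<close>

lemma tree_attach_path:
  assumes "tree W F" "2 \<le> card W" "w \<in> W" "F \<subseteq> E"
    and "Q \<noteq> []" "distinct Q" "set Q \<inter> W = {}" "{w, hd Q} \<in> E" "successively (\<lambda>a b. {a, b} \<in> E) Q"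
  shows "\<exists>F'. tree (W \<union> set Q) F' \<and> F' \<subseteq> E \<and> leaves (W \<union> set Q) F' = insert (last Q) (leaves W F - {w})"
  using assms
proof (induction Q arbitrary: W F w)
  case (Cons u Q)
  let ?W = "insert u W" and ?F = "insert {u, w} F"
  have u: "u \<notin> W" using Cons.prems by auto
  have T: "tree ?W ?F" by (rule tree_attach) (use Cons.prems u in auto)
  have L: "leaves ?W ?F = insert u (leaves W F - {w})"
    by (rule leaves_attach) (use Cons.prems u in auto)
  have E: "?F \<subseteq> E" using Cons.prems by (auto simp: insert_commute)
  show ?case
  proof (cases "Q = []")
    case True
    then show ?thesis using T L E by auto
  next
    case False
    have c: "2 \<le> card ?W"
      using Cons.prems tree_finite(1)[OF Cons.prems(1)] u by simp
    have "{u, hd Q} \<in> E" "successively (\<lambda>a b. {a, b} \<in> E) Q"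
      using Cons.prems False by (auto simp: successively_Cons)
    then have "\<exists>F'. tree (?W \<union> set Q) F' \<and> F' \<subseteq> E \<and>
        leaves (?W \<union> set Q) F' = insert (last Q) (leaves ?W ?F - {u})"
      using Cons.prems False by (intro Cons.IH[OF T c _ E]) auto
    moreover have "leaves ?W ?F - {u} = leaves W F - {w}"
      using L u leaves_subset[of W F] by auto
    ultimately show ?thesis using False by simp
  qed
qed simp

text \<open>Only the parent changes its degree. Removing \<open>p u\<close> from the old leaves
  accounts for a parent of degree 1, which becomes isolated.\<close>

lemma delete_leaf:
  assumes R: "rooted r p h W F" and u: "u \<in> leaves W F" "u \<noteq> r"
  shows "tree (W - {u}) (F - {{u, p u}})"
    and "leaves (W - {u}) (F - {{u, p u}}) =
      leaves W F - {u, p u} \<union> (if degree F (p u) = 2 then {p u} else {})"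
proof -
  have uW: "u \<in> W" "degree F u = 1" using u by (auto simp: leaves_def)
  note pu = rooted_parent[OF R uW(1) u(2)]
  have nochild: "p v \<noteq> u" if "v \<in> W" "v \<noteq> r" for v
    using degree_ge_2_of_child[OF R that] uW(2) u(2) by auto
  have "{v, p v} \<noteq> {u, p u}" if "v \<in> W" "v \<noteq> r" "v \<noteq> u" for v
    using nochild[OF that(1,2)] that(3) by (auto simp: doubleton_eq_iff)
  then have "F - {{u, p u}} = (\<lambda>v. {v, p v}) ` (W - {u} - {r})"
    unfolding rootedD(4)[OF R] by auto
  then have "rooted r p h (W - {u}) (F - {{u, p u}})"
    using R u nochild unfolding rooted_def by auto
  then show "tree (W - {u}) (F - {{u, p u}})" unfolding tree_def by blast
  note deg = degree_remove[OF rootedD(3)[OF R] pu(4)]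
  have d: "degree (F - {{u, p u}}) (p u) + 1 = degree F (p u)" using deg[of "p u"] by simp
  have d': "degree (F - {{u, p u}}) v = degree F v" if "v \<noteq> u" "v \<noteq> p u" for v
    using deg[of v] that by simp
  show "leaves (W - {u}) (F - {{u, p u}}) =
      leaves W F - {u, p u} \<union> (if degree F (p u) = 2 then {p u} else {})"
  proof (intro set_eqI)
    fix v
    show "v \<in> leaves (W - {u}) (F - {{u, p u}}) \<longleftrightarrow>
      v \<in> leaves W F - {u, p u} \<union> (if degree F (p u) = 2 then {p u} else {})"
      using d d'[of v] pu(1,3) by (cases "v = p u") (auto simp: leaves_def)
  qed
qed

text \<open>The subtree of \<open>v\<close> is hung directly below the root. The same heights serve,
  since the root is lowest; \<open>v\<close> loses one edge and gains one.\<close>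

lemma move_to_root:
  assumes R: "rooted x p h W F" and v: "v \<in> W" "v \<noteq> x" "p v \<noteq> x"
  defines "F' \<equiv> insert {x, v} (F - {{v, p v}})"
  shows "rooted x (p(v := x)) h W F'"
    and "degree F' x = degree F x + 1"
    and "degree F' (p v) + 1 = degree F (p v)"
    and "\<And>y. y \<noteq> x \<Longrightarrow> y \<noteq> p v \<Longrightarrow> degree F' y = degree F y"
proof -
  note pv = rooted_parent[OF R v(1,2)]
  have ne: "{y, p y} \<noteq> {v, p v}" if "y \<in> W" "y \<noteq> x" "y \<noteq> v" for y
    using rooted_parent(2)[OF R that(1,2)] pv(2) that by (auto simp: doubleton_eq_iff)
  have "(\<lambda>y. {y, (p(v := x)) y}) ` (W - {x}) = insert {v, x} ((\<lambda>y. {y, p y}) ` (W - {x} - {v}))"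
    using v by auto
  also have "(\<lambda>y. {y, p y}) ` (W - {x} - {v}) = F - {{v, p v}}"
    unfolding rootedD(4)[OF R] using ne by auto
  finally have "F' = (\<lambda>y. {y, (p(v := x)) y}) ` (W - {x})"
    by (simp add: F'_def insert_commute)
  then show "rooted x (p(v := x)) h W F'"
    using R rooted_height_pos[OF R v(1,2)] unfolding rooted_def by auto
  have nF: "{x, v} \<notin> F - {{v, p v}}"
    using rooted_edge[OF R, of x v] v by auto
  have D: "degree F' y = degree (F - {{v, p v}}) y + (if y \<in> {x, v} then 1 else 0)" for y
    unfolding F'_def using degree_insert[OF _ nF, of y] rootedD(3)[OF R] by simp
  note D' = degree_remove[OF rootedD(3)[OF R] pv(4)]
  show "degree F' x = degree F x + 1" using D[of x] D'[of x] v by auto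
  show "degree F' (p v) + 1 = degree F (p v)" using D[of "p v"] D'[of "p v"] v pv(3) by auto
  show "degree F' y = degree F y" if "y \<noteq> x" "y \<noteq> p v" for y
    using D[of y] D'[of y] that by (auto split: if_splits)
qed

text \<open>Adding the edge \<open>{a, b}\<close> closes a cycle. As there is a third leaf, the
  cycle contains a branch vertex \<open>p c\<close>, and the cycle is cut at its edge to
  \<open>c\<close>.\<close>

lemma join_leaves:
  assumes T: "tree W F" and ab: "a \<in> leaves W F" "b \<in> leaves W F" "a \<noteq> b" and three: "3 \<le> card (leaves W F)"
  shows "\<exists>F'. tree W F' \<and> F' \<subseteq> insert {a, b} F \<and> card (leaves W F') < card (leaves W F)"
proof -
  have aW: "a \<in> W" "b \<in> W" "degree F a = 1" "degree F b = 1" using ab by (auto simp: leaves_def)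
  obtain p h where R: "rooted a p h W F" using tree_root[OF T aW(1)] by blast
  let ?P = "ancestors p a b"
  have PW: "?P \<subseteq> W" by (rule ancestors_subset[OF R aW(2)])
  have child: "\<exists>c\<in>?P. c \<noteq> a \<and> p c = v" if "v \<in> ?P" "v \<noteq> b" for v
    using that by (rule ancestors_child)
  have "\<exists>c\<in>?P. c \<noteq> a \<and> 3 \<le> degree F (p c)"
  proof (rule ccontr)
    \<comment> \<open>Without a branch vertex each vertex of the path except \<open>b\<close> has
      its only child on the path, and \<open>b\<close> has none. The path then exhausts the tree,
      leaving only the leaves \<open>a\<close> and \<open>b\<close>.\<close>
    assume neg: "\<not> (\<exists>c\<in>?P. c \<noteq> a \<and> 3 \<le> degree F (p c))"
    have all: "v \<in> ?P" if "v \<in> W" for v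
      using R that
    proof (induction rule: rooted_induct)
      case root
      show ?case by (rule root_in_ancestors[OF R aW(2)])
    next
      case (step v)
      have "p v \<noteq> b" using degree_ge_2_of_child[OF R step(1,2)] aW(4) ab(3) by auto
      then obtain c where c: "c \<in> ?P" "c \<noteq> a" "p c = p v" using child[OF step(3)] by blast
      have "degree F (p v) \<le> 2" using neg c by auto
      then have "v = c"
        using c PW step aW(3) by (intro child_edges[OF R step(1,2) _ c(2) refl c(3)]) auto
      with c show ?case by simp
    qed
    have "leaves W F \<subseteq> {a, b}"
    proof
      fix v assume v: "v \<in> leaves W F"
      show "v \<in> {a, b}"
      proof (rule ccontr)
        assume "v \<notin> {a, b}"
        moreover have "v \<in> ?P" using v all by (auto simp: leaves_def)
        ultimately obtain c where "c \<in> ?P" "c \<noteq> a" "p c = v" using child[of v] by blast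
        then show False
          using degree_ge_2_of_child[OF R, of c] PW v \<open>v \<notin> {a, b}\<close> by (auto simp: leaves_def)
      qed
    qed
    then have "card (leaves W F) \<le> card {a, b}" by (intro card_mono) auto
    with three ab(3) show False by simp
  qed
  then obtain c where c: "c \<in> ?P" "c \<noteq> a" "3 \<le> degree F (p c)" by blast
  have cW: "c \<in> W" using c PW by blast
  note pc = rooted_parent[OF R cW c(2)]
  have pca: "p c \<noteq> a" "p c \<noteq> b" using c(3) aW by auto
  define F' where "F' = insert {b, a} (F - {{c, p c}})"
  have "c \<notin> ancestors p a a" using c(2) ancestors_unfold[of p a a] by simp
  then have T': "tree W F'"
    unfolding F'_def using tree_exchange[OF R c(1,2) aW(2,1)] by simp
  \<comment> \<open>Otherwise the path would consist of \<open>a\<close> and \<open>b\<close> alone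
    and contain no branch vertex.\<close>
  have "{b, a} \<notin> F"
  proof
    assume "{b, a} \<in> F"
    then have "p b = a" using rooted_edge[OF R, of b a] by auto
    then have "?P = {b, a}"
      using ancestors_unfold[of p a b] ancestors_unfold[of p a a] ab(3) by auto
    with c(1,2) \<open>p b = a\<close> pca show False by auto
  qed
  then have D: "degree F' y = degree (F - {{c, p c}}) y + (if y \<in> {b, a} then 1 else 0)" for y
    unfolding F'_def using degree_insert[of "F - {{c, p c}}"] rootedD(3)[OF R] by simp
  note D' = degree_remove[OF rootedD(3)[OF R] pc(4)]
  \<comment> \<open>The branch vertex \<open>p c\<close> keeps degree at least 2, and
    \<open>a\<close> and \<open>b\<close> rise to degree 2 unless \<open>b = c\<close>. So at most
    one leaf arises in exchange for two.\<close>
  have "leaves W F' \<subseteq> insert c (leaves W F - {a, b})"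
  proof
    fix y assume y: "y \<in> leaves W F'"
    then have y1: "y \<in> W" "degree F' y = 1" by (auto simp: leaves_def)
    show "y \<in> insert c (leaves W F - {a, b})"
      using D[of y] D'[of y] y1 aW c(2,3) pca pc(3)
      by (cases "y = c"; cases "y = p c"; cases "y = a"; cases "y = b") (auto simp: leaves_def)
  qed
  then have "card (leaves W F') \<le> card (insert c (leaves W F - {a, b}))"
    using tree_finite_leaves[OF T] by (intro card_mono) auto
  also have "\<dots> \<le> Suc (card (leaves W F - {a, b}))" by (rule card_insert_le_m1[THEN le_trans]) auto
  also have "card (leaves W F - {a, b}) = card (leaves W F) - 2"
    using ab by (subst card_Diff_subset) auto
  finally have "card (leaves W F') < card (leaves W F)" using three by simp
  moreover have "F' \<subseteq> insert {a, b} F" unfolding F'_def by (auto simp: insert_commute)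
  ultimately show ?thesis using T' by blast
qed

section \<open>Largest trees with a path attached\<close>

text \<open>The situation to be refuted: a largest \<open>k\<close>-ended tree with an edge outside
  it. Maximality of \<open>Q\<close> enters only as a hypothesis of
  \<open>independent_triple\<close>.\<close>

locale largest_ended_tree =
  fixes V :: "'a set" and E :: "'a set set" and k :: nat
    and W :: "'a set" and F :: "'a set set" and Q :: "'a list"
  assumes graph: "simple_graph V E" and k: "2 \<le> k"
    and T: "tree W F" "W \<subseteq> V" "F \<subseteq> E" "card (leaves W F) \<le> k"
    and largest: "\<And>X D. tree X D \<Longrightarrow> X \<subseteq> V \<Longrightarrow> D \<subseteq> E \<Longrightarrow> card (leaves X D) \<le> k \<Longrightarrow> card X \<le> card W"
    and Q: "2 \<le> length Q" "distinct Q" "set Q \<subseteq> V - W" "successively (\<lambda>a b. {a, b} \<in> E) Q"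
    and attached: "\<exists>w\<in>W. {w, hd Q} \<in> E"
begin

text \<open>Either end of \<open>Q\<close> counts because \<open>Q\<close> may be attached in
  reverse. The end \<open>hd Q\<close> guarantees that an attachment exists; through
  \<open>last Q\<close> all its neighbours in \<open>W\<close> are covered.\<close>

definition attachments :: "'a set" where
  "attachments = {w \<in> W. {w, hd Q} \<in> E \<or> {w, last Q} \<in> E}"

lemma attachments_nonempty: "\<exists>w. w \<in> attachments"
  using attached by (auto simp: attachments_def)

text \<open>A vertex of \<open>W\<close> followed by \<open>Q\<close> is a path on at least three
  vertices, and it has at most \<open>2 \<le> k\<close> leaves. Hence trees missing one vertex of
  \<open>W\<close> still have two vertices.\<close>

lemma card_ge_3: "3 \<le> card W"
proof -
  obtain w where w: "w \<in> W" "{w, hd Q} \<in> E" using attached by blast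
  have ne: "Q \<noteq> []" "tl Q \<noteq> []" using Q(1) by (cases Q; auto)+
  then have Qeq: "Q = hd Q # tl Q" by simp
  have hd: "hd Q \<noteq> w" using w Q(3) ne by (metis DiffD2 hd_in_set subsetD)
  have wQ: "w \<notin> set Q" using w Q(3) by blast
  have tree2: "tree {w, hd Q} {{w, hd Q}}" using tree_attach[OF tree_singleton, of "hd Q" "hd Q" w] hd by simp
  have "{hd Q, hd (tl Q)} \<in> E \<and> successively (\<lambda>a b. {a, b} \<in> E) (tl Q)"
    using Q(4) ne by (cases Q; cases "tl Q") auto
  moreover have "distinct (tl Q)" "set (tl Q) \<inter> {w, hd Q} = {}"
    using Q(2) wQ by (cases Q; auto)+
  ultimately obtain D where D: "tree ({w, hd Q} \<union> set (tl Q)) D" "D \<subseteq> E"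
    "leaves ({w, hd Q} \<union> set (tl Q)) D = insert (last (tl Q)) (leaves {w, hd Q} {{w, hd Q}} - {hd Q})"
    using tree_attach_path[OF tree2, of "hd Q" E "tl Q"] ne(2) w(2) hd by auto
  have X: "{w, hd Q} \<union> set (tl Q) = insert w (set Q)" by (cases Q) (use ne in auto)
  have "leaves {w, hd Q} {{w, hd Q}} - {hd Q} \<subseteq> {w}" using leaves_subset by fastforce
  then have "leaves (insert w (set Q)) D \<subseteq> {last (tl Q), w}" using D(3) X by auto
  then have "card (leaves (insert w (set Q)) D) \<le> card {last (tl Q), w}" by (intro card_mono) auto
  also have "\<dots> \<le> k" using k card_2_iff by (auto simp: card_insert_if)
  finally have "card (insert w (set Q)) \<le> card W"
    using D(1,2) X w T(2) Q(3) by (intro largest[of _ D]) auto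
  then show ?thesis using wQ Q(1,2) by (simp add: distinct_card)
qed

lemma attach_Q:
  assumes "tree X D" "X \<subseteq> W" "D \<subseteq> E" "2 \<le> card X" "w \<in> attachments" "w \<in> X"
  shows "\<exists>z D'. z \<in> set Q \<and> tree (X \<union> set Q) D' \<and> D' \<subseteq> E \<and>
    leaves (X \<union> set Q) D' = insert z (leaves X D - {w})"
proof -
  have ne: "Q \<noteq> []" using Q(1) by auto
  have dis: "set Q \<inter> X = {}" using Q(3) assms(2) by auto
  from assms(5) consider "{w, hd Q} \<in> E" | "{w, last Q} \<in> E" by (auto simp: attachments_def)
  then show ?thesis
  proof cases
    case 1
    then show ?thesis
      using tree_attach_path[OF assms(1,4,6,3) ne Q(2) dis 1 Q(4)] ne by (metis last_in_set)
  next
    case 2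
    have "successively (\<lambda>a b. {a, b} \<in> E) (rev Q)"
      using Q(4) by (simp add: successively_rev insert_commute)
    then show ?thesis
      using tree_attach_path[OF assms(1,4,6,3), of "rev Q"] ne Q(2) dis 2
      by (metis distinct_rev hd_rev last_in_set rev_is_Nil_conv set_rev)
  qed
qed

lemma card_Un_Q:
  assumes "X \<subseteq> W" "card W \<le> card X + 1"
  shows "card W < card (X \<union> set Q)"
proof -
  have "finite X" using assms(1) tree_finite(1)[OF T(1)] by (rule finite_subset)
  then have "card (X \<union> set Q) = card X + length Q"
    using assms Q(2,3) by (subst card_Un_disjoint) (auto simp: distinct_card)
  then show ?thesis using assms(2) Q(1) by simp
qed

text \<open>Since \<open>Q\<close> has at least two vertices, trees which miss one vertex of \<open>W\<close> also become larger
  than \<open>W\<close> when \<open>Q\<close> is attached.\<close>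

lemma leaves_ge:
  assumes X: "tree X D" "X \<subseteq> W" "D \<subseteq> E" "card W \<le> card X + 1" and w: "w \<in> attachments" "w \<in> X"
  shows "k \<le> card (leaves X D - {w})"
proof (rule ccontr)
  assume neg: "\<not> k \<le> card (leaves X D - {w})"
  have "2 \<le> card X" using card_ge_3 X(4) by simp
  then obtain z D' where D': "tree (X \<union> set Q) D'" "D' \<subseteq> E"
    "leaves (X \<union> set Q) D' = insert z (leaves X D - {w})"
    using attach_Q[OF X(1,2,3) _ w] by blast
  have "card (leaves (X \<union> set Q) D') \<le> Suc (card (leaves X D - {w}))"
    unfolding D'(3) using tree_finite_leaves[OF X(1)] by (simp add: card_insert_if)
  then have "card (X \<union> set Q) \<le> card W"
    using D' neg X(2) Q(3) T(2) by (intro largest[of _ D']) auto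
  then show False using card_Un_Q[OF X(2,4)] by simp
qed

text \<open>If \<open>w\<close> is a leaf, \<open>leaves_ge\<close> is already strict. Otherwise
  attaching \<open>Q\<close> creates one more leaf, making at least three, and joining
  \<open>a\<close> to \<open>b\<close> saves a leaf again; with at most \<open>k\<close> leaves at
  the start this would be a larger \<open>k\<close>-ended tree.\<close>

lemma leaves_gt_of_adjacent:
  assumes X: "tree X D" "X \<subseteq> W" "D \<subseteq> E" "card W \<le> card X + 1" and w: "w \<in> attachments" "w \<in> X"
    and ab: "a \<in> leaves X D" "b \<in> leaves X D" "a \<noteq> b" "{a, b} \<in> E"
  shows "k < card (leaves X D)"
proof (cases "w \<in> leaves X D")
  case True
  then show ?thesis
    using leaves_ge[OF X w] tree_finite_leaves[OF X(1)] k by (simp add: card_Diff_singleton)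
next
  case False
  have "2 \<le> card X" using card_ge_3 X(4) by simp
  then obtain z D' where z: "z \<in> set Q" and D': "tree (X \<union> set Q) D'" "D' \<subseteq> E"
    "leaves (X \<union> set Q) D' = insert z (leaves X D)"
    using attach_Q[OF X(1,2,3) _ w] False by auto
  have "z \<notin> leaves X D" using z X(2) Q(3) leaves_subset[of X D] by blast
  then have c: "card (leaves (X \<union> set Q) D') = Suc (card (leaves X D))"
    using D'(3) tree_finite_leaves[OF X(1)] by simp
  have "card {a, b} \<le> card (leaves X D)"
    using ab tree_finite_leaves[OF X(1)] by (intro card_mono) auto
  then have "3 \<le> card (leaves (X \<union> set Q) D')" using c ab(3) by simp
  moreover have "a \<in> leaves (X \<union> set Q) D'" "b \<in> leaves (X \<union> set Q) D'" using ab D'(3) by auto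
  ultimately obtain D'' where D'': "tree (X \<union> set Q) D''" "D'' \<subseteq> insert {a, b} D'"
    "card (leaves (X \<union> set Q) D'') < card (leaves (X \<union> set Q) D')"
    using join_leaves[OF D'(1) _ _ ab(3)] by blast
  show ?thesis
  proof (rule ccontr)
    assume "\<not> ?thesis"
    then have "card (X \<union> set Q) \<le> card W"
      using D'' D'(2) c ab(4) X(2) Q(3) T(2) by (intro largest[of _ D'']) auto
    then show False using card_Un_Q[OF X(2,4)] by simp
  qed
qed

section \<open>Leaves of the largest tree, their neighbours and their parents\<close>

lemma card_leaves: "card (leaves W F) = k"
proof -
  obtain w where w: "w \<in> attachments" using attachments_nonempty by blast
  then have "w \<in> W" by (simp add: attachments_def)
  then have "k \<le> card (leaves W F - {w})" using leaves_ge[OF T(1) _ T(3) _ w] by simp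
  also have "\<dots> \<le> card (leaves W F)" using tree_finite_leaves[OF T(1)] by (intro card_mono) auto
  finally show ?thesis using T(4) by simp
qed

lemma finite_leaves: "finite (leaves W F)"
  by (rule tree_finite_leaves[OF T(1)])

text \<open>The counterpart of \<open>leaves_ge\<close>: an altered tree whose leaves, apart from
  the attachment, are old leaves other than \<open>x\<close> has too few of them.\<close>

lemma card_leaves_less:
  assumes "S \<subseteq> leaves W F - {x}" "x \<in> leaves W F"
  shows "card S < k"
proof -
  have "card S \<le> card (leaves W F - {x})" using assms finite_leaves by (intro card_mono) auto
  also have "\<dots> < card (leaves W F)" using assms finite_leaves by (intro psubset_card_mono) auto
  finally show ?thesis by (simp add: card_leaves)
qed

lemma leaf_not_attachment:
  assumes "x \<in> leaves W F"
  shows "x \<notin> attachments"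
proof
  assume "x \<in> attachments"
  then have "k \<le> card (leaves W F - {x})"
    using leaves_ge[OF T(1) _ T(3), of x] assms by (simp add: leaves_def)
  then show False using card_leaves_less[OF _ assms, of "leaves W F - {x}"] by simp
qed

text \<open>An outside neighbour could be attached at \<open>x\<close>, taking over the role of
  \<open>x\<close> as a leaf.\<close>

lemma leaf_neighbour:
  assumes x: "x \<in> leaves W F" and u: "{x, u} \<in> E"
  shows "u \<in> W"
proof (rule ccontr)
  assume uW: "u \<notin> W"
  have xW: "x \<in> W" using x by (simp add: leaves_def)
  have c: "2 \<le> card W" using card_ge_3 by simp
  have "leaves (insert u W) (insert {u, x} F) = insert u (leaves W F - {x})"
    using leaves_attach[OF T(1) xW uW c] .
  then have "card (leaves (insert u W) (insert {u, x} F)) \<le> Suc (card (leaves W F - {x}))"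
    using finite_leaves by (simp add: card_insert_if)
  also have "\<dots> \<le> k" using card_leaves_less[OF _ x, of "leaves W F - {x}"] by simp
  finally have "card (insert u W) \<le> card W"
    using tree_attach[OF T(1) xW uW] simple_graph_edgeD(2)[OF graph u] T(2,3) u
    by (intro largest[of _ "insert {u, x} F"]) (auto simp: insert_commute)
  then show False using uW tree_finite(1)[OF T(1)] by simp
qed

lemma leaves_not_adjacent:
  assumes "x \<in> leaves W F" "y \<in> leaves W F"
  shows "{x, y} \<notin> E"
proof
  assume e: "{x, y} \<in> E"
  obtain w where w: "w \<in> attachments" using attachments_nonempty by blast
  then have "w \<in> W" by (simp add: attachments_def)
  then have "k < card (leaves W F)"
    using leaves_gt_of_adjacent[OF T(1) _ T(3) _ w _ assms simple_graph_edgeD(3)[OF graph e] e] by simp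
  then show False by (simp add: card_leaves)
qed

text \<open>Delete \<open>x\<close>. A parent of degree other than 2 does not become a leaf, so a
  leaf is lost; a parent that is an attachment may become a leaf, but \<open>Q\<close> can be
  attached there.\<close>

lemma leaf_parent:
  assumes R: "rooted r p h W F" and x: "x \<in> leaves W F" "x \<noteq> r"
  shows "degree F (p x) = 2" and "p x \<notin> attachments"
proof -
  let ?X = "W - {x}" and ?D = "F - {{x, p x}}"
  note D = delete_leaf[OF R x]
  have xW: "x \<in> W" using x by (simp add: leaves_def)
  have c: "card W \<le> card ?X + 1" using xW by (simp add: card_Diff_singleton tree_finite(1)[OF T(1)])
  have ge: "k \<le> card (leaves ?X ?D - {w})" if "w \<in> attachments" for w
    using that leaf_not_attachment[OF x(1)] T(3)
    by (intro leaves_ge[OF D(1) _ _ c that]) (auto simp: attachments_def)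
  obtain w where w: "w \<in> attachments" using attachments_nonempty by blast
  show "degree F (p x) = 2"
  proof (rule ccontr)
    assume "degree F (p x) \<noteq> 2"
    then have "leaves ?X ?D - {w} \<subseteq> leaves W F - {x}" using D(2) by auto
    from card_leaves_less[OF this x(1)] show False using ge[OF w] by simp
  qed
  show "p x \<notin> attachments"
  proof
    assume w: "p x \<in> attachments"
    have "leaves ?X ?D - {p x} \<subseteq> leaves W F - {x}" using D(2) by auto
    from card_leaves_less[OF this x(1)] show False using ge[OF w] by simp
  qed
qed

section \<open>Predecessors of the neighbours of a leaf, in the tree rooted at that leaf\<close>

context
  fixes x v :: 'a and p h
  assumes R: "rooted x p h W F" and x: "x \<in> leaves W F" and v: "{x, v} \<in> E"
begin

lemma neighbour_in_tree: "v \<in> W" "v \<noteq> x"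
  using leaf_neighbour[OF x v] simple_graph_edgeD(3)[OF graph v] by auto

text \<open>As \<open>x\<close> is the root, \<open>{v, p v}\<close> is the edge from
  \<open>v\<close> towards \<open>x\<close>. Exchanging it for \<open>{x, v}\<close> ends the leaf
  \<open>x\<close>; by maximality a leaf must appear instead, and only \<open>p v\<close> can become
  one.\<close>

lemma move_leaf:
  assumes u: "p v \<noteq> x"
  defines "D \<equiv> insert {x, v} (F - {{v, p v}})"
  shows "rooted x (p(v := x)) h W D" "D \<subseteq> E" "degree F (p v) = 2" "degree D x = 2"
    and "\<And>y. y \<noteq> x \<Longrightarrow> y \<noteq> p v \<Longrightarrow> degree D y = degree F y"
    and "leaves W D = insert (p v) (leaves W F - {x})"
proof -
  note m = move_to_root[OF R neighbour_in_tree u, folded D_def]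
  note pv = rooted_parent[OF R neighbour_in_tree]
  show D: "rooted x (p(v := x)) h W D" by (rule m(1))
  show DE: "D \<subseteq> E" using T(3) v by (auto simp: D_def)
  have dx: "degree F x = 1" using x by (simp add: leaves_def)
  then show D2: "degree D x = 2" using m(2) by simp
  show deg: "degree D y = degree F y" if "y \<noteq> x" "y \<noteq> p v" for y using m(4) that .
  have sub: "y \<in> leaves W F - {x}" if "y \<in> leaves W D" "y \<noteq> p v" for y
    using that deg[of y] D2 by (cases "y = x") (auto simp: leaves_def)
  have two: "2 \<le> degree F (p v)" by (rule degree_ge_2_of_child[OF R neighbour_in_tree u])
  show d: "degree F (p v) = 2"
  proof (rule ccontr)
    assume "degree F (p v) \<noteq> 2"
    then have "p v \<notin> leaves W D" using m(3) two by (auto simp: leaves_def)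
    then have "leaves W D \<subseteq> leaves W F - {x}" using sub by blast
    moreover obtain w where w: "w \<in> attachments" using attachments_nonempty by blast
    moreover have "tree W D" using D unfolding tree_def by blast
    ultimately have "k \<le> card (leaves W D - {w})" "leaves W D - {w} \<subseteq> leaves W F - {x}"
      using leaves_ge[of W D w] DE by (auto simp: attachments_def)
    then show False using card_leaves_less[OF _ x] by (metis not_less)
  qed
  have "y \<in> leaves W D" if "y \<in> leaves W F - {x}" for y
    using that deg[of y] d by (cases "y = p v") (auto simp: leaves_def)
  moreover have "p v \<in> leaves W D" using m(3) d pv(1) by (simp add: leaves_def)
  ultimately show "leaves W D = insert (p v) (leaves W F - {x})" using sub by blast
qed

text \<open>Either \<open>p v\<close> is \<open>x\<close> itself or it is a leaf of the exchanged
  tree, which is just as large with as many leaves. So it obeys the restrictions on leaves.\<close>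

lemma predecessor:
  shows "p v = x \<or> degree F (p v) = 2" and "p v \<notin> attachments"
    and "\<And>y. y \<in> leaves W F \<Longrightarrow> y \<noteq> x \<Longrightarrow> {y, p v} \<notin> E"
proof -
  show "p v = x \<or> degree F (p v) = 2" using move_leaf(3) by blast
  show "p v \<notin> attachments"
  proof (cases "p v = x")
    case True
    then show ?thesis using leaf_not_attachment[OF x] by simp
  next
    case False
    note m = move_leaf[OF False]
    have tr: "tree W (insert {x, v} (F - {{v, p v}}))" using m(1) unfolding tree_def by blast
    show ?thesis
    proof
      assume "p v \<in> attachments"
      then have "k \<le> card (leaves W (insert {x, v} (F - {{v, p v}})) - {p v})"
        using leaves_ge[OF tr _ m(2)] by (simp add: attachments_def)
      moreover have "leaves W (insert {x, v} (F - {{v, p v}})) - {p v} \<subseteq> leaves W F - {x}"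
        using m(6) by blast
      ultimately show False using card_leaves_less[OF _ x] by (metis not_less)
    qed
  qed
  show "{y, p v} \<notin> E" if y: "y \<in> leaves W F" "y \<noteq> x" for y
  proof (cases "p v = x")
    case True
    then show ?thesis using leaves_not_adjacent[OF y(1) x] by simp
  next
    case False
    note m = move_leaf[OF False]
    have tr: "tree W (insert {x, v} (F - {{v, p v}}))" using m(1) unfolding tree_def by blast
    obtain w where w: "w \<in> attachments" using attachments_nonempty by blast
    show ?thesis
    proof
      assume e: "{y, p v} \<in> E"
      have "k < card (leaves W (insert {x, v} (F - {{v, p v}})))"
        using w y m(6) simple_graph_edgeD(3)[OF graph e]
        by (intro leaves_gt_of_adjacent[OF tr _ m(2) _ w, of y "p v"] e) (auto simp: attachments_def)
      moreover have "card (insert (p v) (leaves W F - {x})) \<le> k"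
        using card_leaves_less[OF _ x, of "leaves W F - {x}"] finite_leaves by (simp add: card_insert_if)
      ultimately show False using m(6) by simp
    qed
  qed
qed

text \<open>The exchange makes \<open>p v\<close> a leaf, which is then deleted; now
  \<open>p (p v)\<close> plays the part of the new leaf. The missing vertex is made up for by
  \<open>Q\<close>.\<close>

lemma second_predecessor:
  assumes u: "p v \<noteq> x"
  shows "p (p v) = x \<or> degree F (p (p v)) = 2" and "p (p v) \<notin> attachments"
    and "\<And>y. y \<in> leaves W F \<Longrightarrow> y \<noteq> x \<Longrightarrow> {y, p (p v)} \<notin> E"
proof -
  define z where "z = p (p v)"
  define D where "D = insert {x, v} (F - {{v, p v}})"
  note m = move_leaf[OF u, folded D_def]
  note pv = rooted_parent[OF R neighbour_in_tree]
  note z = rooted_parent[OF R pv(1) u, folded z_def]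
  have "p v \<in> leaves W D" using m(6) by simp
  note del = delete_leaf[OF m(1) this u]
  let ?X = "W - {p v}" and ?D = "D - {{p v, z}}"
  have tr: "tree ?X ?D" using del(1) pv(3) by (simp add: z_def)
  have L: "leaves ?X ?D = insert (p v) (leaves W F - {x}) - {p v, z} \<union> (if degree D z = 2 then {z} else {})"
    using del(2) pv(3) m(6) by (simp add: z_def)
  have c: "card W \<le> card ?X + 1"
    using pv(1) by (simp add: card_Diff_singleton tree_finite(1)[OF T(1)])
  have DE: "?D \<subseteq> E" using m(2) by blast
  have att: "w \<in> ?X" if "w \<in> attachments" for w
    using that predecessor(2) by (auto simp: attachments_def)
  have ge: "k \<le> card (leaves ?X ?D - {w})" if "w \<in> attachments" for w
    using leaves_ge[OF tr _ DE c that att[OF that]] by blast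
  obtain w where w: "w \<in> attachments" using attachments_nonempty by blast
  have dz: "z = x \<or> degree F z = 2"
  proof (rule ccontr)
    assume neg: "\<not> (z = x \<or> degree F z = 2)"
    then have "degree D z \<noteq> 2" using m(5)[of z] z(3) by simp
    then have "leaves ?X ?D - {w} \<subseteq> leaves W F - {x}" using L by auto
    from card_leaves_less[OF this x] show False using ge[OF w] by simp
  qed
  then show "p (p v) = x \<or> degree F (p (p v)) = 2" by (simp add: z_def)
  \<comment> \<open>This includes \<open>z = x\<close>, which has gained the edge to
    \<open>v\<close>.\<close>
  have "degree D z = 2" using dz m(4) m(5)[of z] z(3) by (cases "z = x") simp_all
  then have L: "leaves ?X ?D = insert z (leaves W F - {x} - {p v})"
    using L by auto
  have "z \<notin> attachments"
  proof
    assume w: "z \<in> attachments"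
    have "leaves ?X ?D - {z} \<subseteq> leaves W F - {x}" using L by auto
    from card_leaves_less[OF this x] show False using ge[OF w] by simp
  qed
  then show "p (p v) \<notin> attachments" by (simp add: z_def)
  show "{y, p (p v)} \<notin> E" if y: "y \<in> leaves W F" "y \<noteq> x" for y
  proof
    assume "{y, p (p v)} \<in> E"
    then have e: "{y, z} \<in> E" by (simp add: z_def)
    \<comment> \<open>Hence \<open>y\<close> survives the deletion and is still a leaf.\<close>
    have "y \<noteq> p v" using y m(3) by (auto simp: leaves_def)
    then have "k < card (leaves ?X ?D)"
      using y L simple_graph_edgeD(3)[OF graph e]
      by (intro leaves_gt_of_adjacent[OF tr _ DE c w att[OF w], of y z] e) auto
    also have "card (leaves ?X ?D) \<le> Suc (card (leaves W F - {x} - {p v}))"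
      using L finite_leaves by (simp add: card_insert_if)
    also have "\<dots> \<le> k" using card_leaves_less[OF _ x, of "leaves W F - {x} - {p v}"] by auto
    finally show False by simp
  qed
qed

end

text \<open>Neighbours of the leaf \<open>a\<close> and of the leaf \<open>b\<close> are moved one step along the tree, those
  on the path \<open>P\<close> from \<open>b\<close> to \<open>a\<close> towards \<open>a\<close> and \<open>b\<close> respectively, those off \<open>P\<close> one step
  and two steps towards \<open>P\<close>. Neighbours of \<open>last Q\<close> stay put. The images do not overlap, and
  they avoid the remaining leaves and the tree neighbours of these.\<close>

lemma neighbours_le:
  assumes ab: "a \<in> leaves W F" "b \<in> leaves W F" "a \<noteq> b"
  shows "card {v. {a, v} \<in> E} + card {v. {b, v} \<in> E} + card {w \<in> W. {last Q, w} \<in> E} + 2 * (k - 2) \<le> card W"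
proof -
  define A where "A = {v. {a, v} \<in> E}"
  define B where "B = {v. {b, v} \<in> E}"
  define C where "C = {w \<in> W. {last Q, w} \<in> E}"
  define L where "L = leaves W F - {a, b}"
  have aW: "a \<in> W" "b \<in> W" "degree F a = 1" "degree F b = 1" using ab by (auto simp: leaves_def)
  have finW: "finite W" by (rule tree_finite(1)[OF T(1)])
  obtain p h where R: "rooted a p h W F" using tree_root[OF T(1) aW(1)] by blast
  define P where "P = ancestors p a b"
  \<comment> \<open>Rooting at \<open>b\<close> as well makes the predecessor lemmas available for
    both leaves. The two parent functions agree off \<open>P\<close> and are inverse to each other
    along \<open>P\<close>.\<close>
  obtain q g where S: "rooted b q g W F" and qoff: "\<And>v. v \<notin> P \<Longrightarrow> q v = p v"
    and qon: "\<And>v. v \<in> P \<Longrightarrow> v \<noteq> a \<Longrightarrow> q (p v) = v"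
    using reroot[OF R aW(2)] unfolding P_def by blast
  have PW: "P \<subseteq> W" unfolding P_def by (rule ancestors_subset[OF R aW(2)])
  have aP: "a \<in> P" unfolding P_def by (rule root_in_ancestors[OF R aW(2)])
  have bP: "b \<in> P" unfolding P_def by (rule ancestors.self)
  have CW: "C \<subseteq> attachments" by (auto simp: C_def attachments_def insert_commute)
  have AW: "v \<in> W" "v \<noteq> a" if "v \<in> A" for v
    using that neighbour_in_tree[OF R ab(1)] by (auto simp: A_def)
  have BW: "v \<in> W" "v \<noteq> b" if "v \<in> B" for v
    using that neighbour_in_tree[OF S ab(2)] by (auto simp: B_def)
  have A1: "p v = a \<or> degree F (p v) = 2" "p v \<notin> attachments" "p v \<notin> B" if "v \<in> A" for v
    using that predecessor[OF R ab(1), of v] ab by (auto simp: A_def B_def)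
  have A2: "p (p v) \<notin> B" if "v \<in> A" "p v \<noteq> a" for v
    using that second_predecessor(3)[OF R ab(1), of v b] ab by (auto simp: A_def B_def)
  have B1: "q v = b \<or> degree F (q v) = 2" "q v \<notin> attachments" "q v \<notin> A" if "v \<in> B" for v
    using that predecessor[OF S ab(2), of v] ab by (auto simp: A_def B_def)
  have B2: "q (q v) = b \<or> degree F (q (q v)) = 2" "q (q v) \<notin> attachments" if "v \<in> B" "q v \<noteq> b" for v
    using that second_predecessor[OF S ab(2), of v] by (auto simp: B_def)
  have child: "\<exists>c\<in>P. c \<noteq> a \<and> p c = v" if "v \<in> P" "v \<noteq> b" for v
    using that unfolding P_def by (rule ancestors_child)
  have no_child: "p v \<notin> leaves W F" if "v \<in> W" "v \<noteq> a" "p v \<noteq> a" for v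
    using degree_ge_2_of_child[OF R that] by (auto simp: leaves_def)
  have unique: "v = v'" if "v \<in> W" "v \<noteq> a" "v' \<in> W" "v' \<noteq> a" "p v = p v'" "p v = a \<or> degree F (p v) = 2"
    for v v'
    using child_edges[OF R that(1-4) refl that(5)[symmetric]] that(6) aW(3) by (cases "p v = a") simp_all
  \<comment> \<open>A vertex of \<open>P\<close> other than \<open>b\<close> has a child on
    \<open>P\<close>, which is its only child if it is \<open>a\<close> or has degree 2. The leaf
    \<open>b\<close> has no child.\<close>
  have off: "p v \<notin> P" if "v \<in> W" "v \<notin> P" "p v = a \<or> degree F (p v) = 2" for v
  proof
    assume pP: "p v \<in> P"
    have va: "v \<noteq> a" using that(2) aP by blast
    then have "p v \<noteq> b" using no_child[OF that(1) va] ab by metis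
    then obtain c where "c \<in> P" "c \<noteq> a" "p c = p v" using child pP by blast
    then show False using unique[OF that(1) va _ _ _ that(3), of c] PW that(2) by auto
  qed
  \<comment> \<open>Off \<open>P\<close>, \<open>q\<close> is \<open>p\<close>, so the restrictions
    on \<open>q v\<close> and \<open>q (q v)\<close> turn into ones on \<open>p v\<close> and
    \<open>p (p v)\<close>, and both steps stay off \<open>P\<close>.\<close>
  have B_off: "q v = p v" "p v \<in> W" "p v \<notin> P" "degree F (p v) = 2" "q (p v) = p (p v)"
    "p (p v) \<in> W - P" "degree F (p (p v)) = 2" "p (p v) \<notin> attachments" if v: "v \<in> B" "v \<notin> P" for v
  proof -
    have va: "v \<noteq> a" using v(2) aP by blast
    note vW = BW(1)[OF v(1)]
    show q: "q v = p v" by (rule qoff[OF v(2)])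
    show pvW: "p v \<in> W" by (rule rooted_parent(1)[OF R vW va])
    have "p v \<noteq> b" using no_child[OF vW va] ab by metis
    then show d: "degree F (p v) = 2" using B1(1)[OF v(1)] q by simp
    show pvP: "p v \<notin> P" using off[OF vW v(2)] d by simp
    show q2: "q (p v) = p (p v)" by (rule qoff[OF pvP])
    have pva: "p v \<noteq> a" using pvP aP by blast
    have "p (p v) \<noteq> b" using no_child[OF pvW pva] ab by metis
    with B2[OF v(1)] q q2 \<open>p v \<noteq> b\<close>
    show d2: "degree F (p (p v)) = 2" and "p (p v) \<notin> attachments" by auto
    show "p (p v) \<in> W - P"
      using off[OF pvW pvP] d2 rooted_parent(1)[OF R pvW pva] by simp
  qed
  have L: "l \<in> W" "l \<noteq> a" "l \<notin> P" "degree F (p l) = 2" "p l \<in> W - P" "p l \<notin> attachments" if l: "l \<in> L" for l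
  proof -
    have lL: "l \<in> leaves W F" "l \<noteq> b" and la: "l \<noteq> a" using l by (auto simp: L_def)
    show "l \<noteq> a" by (rule la)
    show lW: "l \<in> W" using lL by (simp add: leaves_def)
    show lP: "l \<notin> P"
    proof
      assume "l \<in> P"
      then obtain c where "c \<in> P" "c \<noteq> a" "p c = l" using child lL(2) by blast
      then show False using no_child[of c] PW lL(1) la by auto
    qed
    show d: "degree F (p l) = 2" and "p l \<notin> attachments" using leaf_parent[OF R lL(1) la] by auto
    show "p l \<in> W - P" using off[OF lW lP] d rooted_parent(1)[OF R lW la] by simp
  qed

  have q_on: "\<exists>c\<in>P. c \<noteq> a \<and> p c = v \<and> q v = c" if "v \<in> P" "v \<noteq> b" for v
    using child[OF that] qon by blast
  have injA: "inj_on p A"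
    using unique AW A1(1) by (meson inj_onI)
  have injB1: "inj_on q (B \<inter> P)"
  proof (rule inj_onI)
    fix v v' assume v: "v \<in> B \<inter> P" "v' \<in> B \<inter> P" "q v = q v'"
    obtain c c' where "p c = v" "q v = c" "p c' = v'" "q v' = c'"
      using q_on v BW by blast
    with v show "v = v'" by simp
  qed
  have on: "card (A \<inter> P) + card (B \<inter> P) + card (C \<inter> P) \<le> card P"
  proof -
    have fin: "finite P" using PW finW by (rule finite_subset)
    have cA: "card (p ` (A \<inter> P)) = card (A \<inter> P)"
      using injA by (intro card_image) (auto intro: inj_on_subset)
    have cB: "card (q ` (B \<inter> P)) = card (B \<inter> P)" using injB1 by (rule card_image)
    have sA: "p ` (A \<inter> P) \<subseteq> P" using AW unfolding P_def by (auto intro: ancestors.parent)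
    have sB: "q ` (B \<inter> P) \<subseteq> P" using q_on BW by blast
    have AB: "p ` (A \<inter> P) \<inter> q ` (B \<inter> P) = {}"
    proof (rule ccontr)
      assume "\<not> ?thesis"
      then obtain v z where v: "v \<in> A" and z: "z \<in> B" "z \<in> P" and eq: "p v = q z" by blast
      \<comment> \<open>Since \<open>q\<close> inverts \<open>p\<close> along \<open>P\<close>, the
        equation \<open>p v = q z\<close> gives \<open>p (p v) = z\<close>, a neighbour of
        \<open>b\<close>, against \<open>A2\<close>.\<close>
      obtain c where c: "c \<noteq> a" "p c = z" "q z = c" using q_on[OF z(2) BW(2)[OF z(1)]] by blast
      then show False using A2[OF v] eq z(1) by simp
    qed
    have AC: "(p ` (A \<inter> P) \<union> q ` (B \<inter> P)) \<inter> (C \<inter> P) = {}" using A1(2) B1(2) CW by blast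
    have "card (A \<inter> P) + card (B \<inter> P) + card (C \<inter> P) =
        card (p ` (A \<inter> P) \<union> q ` (B \<inter> P) \<union> (C \<inter> P))"
      using cA cB sA sB AB AC fin by (simp add: card_Un_disjoint finite_subset)
    also have "\<dots> \<le> card P" using sA sB fin by (intro card_mono) auto
    finally show ?thesis .
  qed
  have "card (A - P) + card (B - P) + card (C - P) + card L + card L \<le> card (W - P)"
  proof -
    \<comment> \<open>Off \<open>P\<close> both leaves lie in the same direction, so single steps
      from \<open>A\<close> and \<open>B\<close> could meet. The second step from \<open>B\<close>
      prevents this.\<close>
    let ?A = "p ` (A - P)" and ?B = "(\<lambda>v. p (p v)) ` (B - P)" and ?L = "p ` L"
    have fin: "finite (W - P)" using finW by simp
    have aP': "v \<noteq> a" if "v \<notin> P" for v using that aP by blast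
    have cA: "card ?A = card (A - P)"
      using injA by (intro card_image) (auto intro: inj_on_subset)
    have "inj_on (\<lambda>v. p (p v)) (B - P)"
    proof (rule inj_onI)
      fix v v' assume v: "v \<in> B - P" "v' \<in> B - P" and eq: "p (p v) = p (p v')"
      have vB: "v \<in> B" "v \<notin> P" "v' \<in> B" "v' \<notin> P" using v by auto
      note v1 = B_off[OF vB(1,2)] and v2 = B_off[OF vB(3,4)]
      have "p v = p v'"
        using unique[OF v1(2) aP'[OF v1(3)] v2(2) aP'[OF v2(3)] eq disjI2[OF v1(7)]] .
      then show "v = v'"
        using unique[OF BW(1)[OF vB(1)] aP'[OF vB(2)] BW(1)[OF vB(3)] aP'[OF vB(4)] _ disjI2[OF v1(4)]] by simp
    qed
    then have cB: "card ?B = card (B - P)" by (rule card_image)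
    have "inj_on p L" using unique L by (meson inj_onI)
    then have cL: "card ?L = card L" by (rule card_image)
    have Aoff: "p v \<in> W - P" if "v \<in> A - P" for v
      using off[of v] A1(1)[of v] AW[of v] rooted_parent(1)[OF R, of v] that by auto
    have sub: "?A \<subseteq> W - P" "?B \<subseteq> W - P" "C - P \<subseteq> W - P" "L \<subseteq> W - P" "?L \<subseteq> W - P"
      using Aoff B_off(6) L by (auto simp: C_def)
    have nl: "p v \<notin> L" if "v \<in> W" "v \<notin> P" "p v \<notin> P" for v
      using no_child[OF that(1) aP'[OF that(2)] aP'[OF that(3)]] by (simp add: L_def)
    have AB: "?A \<inter> ?B = {}"
    proof (rule ccontr)
      assume "\<not> ?thesis"
      then obtain v z where v: "v \<in> A" "v \<notin> P" and z: "z \<in> B" "z \<notin> P" and eq: "p v = p (p z)" by blast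
      note pz = B_off[OF z]
      \<comment> \<open>The only child of \<open>p (p z)\<close> is \<open>p z\<close>; this would
        be a neighbour of \<open>a\<close> preceding the neighbour \<open>z\<close> of
        \<open>b\<close>, against \<open>B1\<close>.\<close>
      have "v = p z"
        using unique[OF AW[OF v(1)] pz(2) aP'[OF pz(3)] eq] pz(7) by (simp only: eq) blast
      then show False using B1(3)[OF z(1)] B_off(1)[OF z] v(1) by simp
    qed
    have ABC: "(?A \<union> ?B) \<inter> (C - P) = {}" using A1(2) B_off(8) CW by blast
    have ABCL: "(?A \<union> ?B \<union> (C - P)) \<inter> L = {}"
    proof -
      have "?A \<inter> L = {}" using nl AW Aoff by blast
      moreover have "?B \<inter> L = {}" using nl B_off(2,3,6) by blast
      moreover have "C \<inter> L = {}" using leaf_not_attachment CW by (auto simp: L_def)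
      ultimately show ?thesis by blast
    qed
    have ABCLL: "(?A \<union> ?B \<union> (C - P) \<union> L) \<inter> ?L = {}"
    proof -
      have eqL: "v = l" if "v \<in> W" "v \<notin> P" "l \<in> L" "p v = p l" for v l
        using unique[OF that(1) aP'[OF that(2)] L(1,2)[OF that(3)] that(4)] L(4)[OF that(3)]
        by (simp add: that(4))
      have "?A \<inter> ?L = {}"
      proof (rule ccontr)
        assume "\<not> ?thesis"
        then obtain v l where v: "v \<in> A" "v \<notin> P" and l: "l \<in> L" and eq: "p v = p l" by blast
        \<comment> \<open>The parent of \<open>l\<close> has only the child \<open>l\<close>, so
          \<open>a\<close> would be adjacent to another leaf.\<close>
        then have "v = l" using eqL AW by blast
        then show False using leaves_not_adjacent[OF ab(1), of l] v l by (simp add: A_def L_def)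
      qed
      moreover have "?B \<inter> ?L = {}"
      proof (rule ccontr)
        assume "\<not> ?thesis"
        then obtain v l where v: "v \<in> B" "v \<notin> P" and l: "l \<in> L" and eq: "p (p v) = p l" by blast
        \<comment> \<open>Here the leaf \<open>l\<close> would be the parent of
          \<open>v\<close>.\<close>
        then have "p v = l" using eqL B_off(2,3) by blast
        then show False using nl[OF BW(1) v(2) B_off(3)] v l by simp
      qed
      moreover have "C \<inter> ?L = {}" using L(6) CW by blast
      moreover have "p l \<notin> L" if "l \<in> L" for l
        using nl[OF L(1,3)[OF that]] L(5)[OF that] by simp
      then have "L \<inter> ?L = {}" by blast
      ultimately show ?thesis by blast
    qed
    have "card (A - P) + card (B - P) + card (C - P) + card L + card L =
        card (?A \<union> ?B \<union> (C - P) \<union> L \<union> ?L)"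
      using cA cB cL sub[THEN finite_subset, OF fin] AB ABC ABCL ABCLL
      by (simp add: card_Un_disjoint)
    also have "\<dots> \<le> card (W - P)" using sub fin by (intro card_mono) auto
    finally show ?thesis .
  qed
  with on have "card (A \<inter> P) + card (A - P) + (card (B \<inter> P) + card (B - P)) +
      (card (C \<inter> P) + card (C - P)) + 2 * card L \<le> card P + card (W - P)"
    by simp
  moreover have "finite A" "finite B" "finite C"
    using AW(1) BW(1) finW by (auto simp: C_def intro: finite_subset[of _ W])
  ultimately have "card A + card B + card C + 2 * card L \<le> card P + card (W - P)"
    by (simp only: card_Int_Diff[symmetric])
  also have "card P + card (W - P) = card W"
    using PW finW card_Int_Diff[OF finW, of P] by (simp add: Int_absorb1)
  also have "card L = k - 2"
    unfolding L_def using ab card_leaves by (subst card_Diff_subset) auto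
  finally show ?thesis unfolding A_def B_def C_def .
qed

text \<open>All neighbours of the two leaves lie in \<open>W\<close>, so neither is adjacent to
  \<open>last Q\<close>. The neighbours of \<open>last Q\<close> outside \<open>W\<close> are among
  the other \<open>length Q - 1\<close> vertices of the path.\<close>

lemma independent_triple:
  assumes maximal: "\<And>u. {last Q, u} \<in> E \<Longrightarrow> u \<in> W \<union> set Q"
  shows "\<exists>S\<subseteq>V. card S = 3 \<and> independent_set E S \<and>
    (\<Sum>v\<in>S. degree E v) + 2 * k \<le> card W + length Q + 3"
proof -
  have "2 \<le> card (leaves W F)" using card_leaves k by simp
  then obtain X where "X \<subseteq> leaves W F" "card X = 2" by (meson obtain_subset_with_card_n)
  then obtain a b where ab: "a \<in> leaves W F" "b \<in> leaves W F" "a \<noteq> b"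
    by (auto simp: card_2_iff)
  let ?y = "last Q"
  have yQ: "?y \<in> set Q" using Q(1) by (intro last_in_set) auto
  then have y: "?y \<in> V" "?y \<notin> W" using Q(3) by auto
  have aW: "a \<in> W" "b \<in> W" using ab by (auto simp: leaves_def)
  have ya: "{x, ?y} \<notin> E" if "x \<in> leaves W F" for x
    using leaf_neighbour[OF that] y by blast
  have loop: "{x, x} \<notin> E" for x using simple_graph_edgeD(3)[OF graph] by blast
  have finW: "finite W" by (rule tree_finite(1)[OF T(1)])
  have "{u. {?y, u} \<in> E} \<subseteq> {w \<in> W. {?y, w} \<in> E} \<union> (set Q - {?y})"
    using maximal loop by auto
  then have "degree E ?y \<le> card ({w \<in> W. {?y, w} \<in> E} \<union> (set Q - {?y}))"
    unfolding degree_eq_card_neighbours[OF graph] using finW by (intro card_mono) auto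
  also have "\<dots> \<le> card {w \<in> W. {?y, w} \<in> E} + card (set Q - {?y})" by (rule card_Un_le)
  also have "card (set Q - {?y}) = length Q - 1" using yQ Q(2) by (simp add: distinct_card)
  finally have "degree E a + degree E b + degree E ?y + 2 * (k - 2) \<le> card W + (length Q - 1)"
    using neighbours_le[OF ab] by (simp add: degree_eq_card_neighbours[OF graph])
  \<comment> \<open>Moving \<open>2 * (k - 2)\<close> across contributes 4 and the path contributes
    -1, whence the constant 3.\<close>
  then have "degree E a + degree E b + degree E ?y + 2 * k \<le> card W + length Q + 3"
    using k Q(1) by simp
  moreover have "independent_set E {a, b, ?y}"
    using loop ya[OF ab(1)] ya[OF ab(2)] leaves_not_adjacent[OF ab(1,2)]
    by (auto simp: independent_set_def insert_commute)
  moreover have "a \<noteq> ?y" "b \<noteq> ?y" using aW y(2) by auto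
  ultimately show ?thesis
    using ab(3) aW y T(2) by (intro exI[of _ "{a, b, ?y}"]) (auto simp: add.assoc)
qed

lemma larger_tree:
  "\<exists>X D. tree X D \<and> X \<subseteq> V \<and> D \<subseteq> E \<and> card (leaves X D) \<le> k + 1 \<and> card X = card W + length Q"
proof -
  obtain w where w: "w \<in> attachments" using attachments_nonempty by blast
  then have "w \<in> W" by (simp add: attachments_def)
  then obtain z D where D: "tree (W \<union> set Q) D" "D \<subseteq> E" "leaves (W \<union> set Q) D = insert z (leaves W F - {w})"
    using attach_Q[OF T(1) subset_refl T(3) _ w] card_ge_3 by auto
  have "card (leaves (W \<union> set Q) D) \<le> Suc (card (leaves W F))"
    unfolding D(3) using card_Diff1_le[of "leaves W F" w] finite_leaves
    by (simp add: card_insert_if)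
  moreover have "card (W \<union> set Q) = card W + length Q"
    using tree_finite(1)[OF T(1)] Q(2,3) by (subst card_Un_disjoint) (auto simp: distinct_card)
  ultimately show ?thesis using D T(2) Q(3) card_leaves by (intro exI[of _ "W \<union> set Q"] exI[of _ D]) auto
qed

end

section \<open>Existence of the tree and of the path, and the conclusion\<close>

lemma exists_largest_ended_tree:
  assumes "finite V" "v \<in> V"
  obtains W F where "tree W F" "W \<subseteq> V" "F \<subseteq> E" "card (leaves W F) \<le> k"
    and "\<And>X D. tree X D \<Longrightarrow> X \<subseteq> V \<Longrightarrow> D \<subseteq> E \<Longrightarrow> card (leaves X D) \<le> k \<Longrightarrow> card X \<le> card W"
proof -
  let ?Q = "\<lambda>(X, D). tree X D \<and> X \<subseteq> V \<and> D \<subseteq> E \<and> card (leaves X D) \<le> k"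
  \<comment> \<open>A single vertex has degree 0, so this tree has no leaves and qualifies for every
    \<open>k\<close>.\<close>
  have start: "?Q ({v}, {})" using assms(2) tree_singleton by (auto simp: leaves_def degree_def)
  have bound: "\<forall>y. ?Q y \<longrightarrow> card (fst y) < Suc (card V)"
    using assms(1) by (auto simp: less_Suc_eq_le card_mono)
  from ex_has_greatest_nat[OF start bound]
  obtain x where x: "?Q x \<and> (\<forall>y. ?Q y \<longrightarrow> card (fst y) \<le> card (fst x))" ..
  obtain W F where "x = (W, F)" by (cases x)
  with x have WF: "?Q (W, F)" and mx: "\<And>y. ?Q y \<Longrightarrow> card (fst y) \<le> card W" by auto
  show thesis
    using WF mx[of "(X, D)" for X D] by (intro that[of W F]) simp_all
qed

text \<open>\<open>X\<close> collects the vertices on edges outside \<open>W\<close>. If none of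
  them had a neighbour in \<open>W\<close>, then \<open>X\<close> would be closed under adjacency,
  against connectedness. So some outside edge starts next to \<open>W\<close>, and a longest path of
  this kind cannot be extended at its end.\<close>

lemma exists_maximal_outer_path:
  assumes G: "simple_graph V E" "graph_connected V E" and W: "W \<subseteq> V" "W \<noteq> {}"
    and nd: "\<not> dominating V E W"
  obtains Q where "2 \<le> length Q" "distinct Q" "set Q \<subseteq> V - W" "successively (\<lambda>a b. {a, b} \<in> E) Q"
    and "\<exists>w\<in>W. {w, hd Q} \<in> E" "\<And>u. {last Q, u} \<in> E \<Longrightarrow> u \<in> W \<union> set Q"
proof -
  note edge = simple_graph_edgeD[OF G(1)]
  define X where "X = {v \<in> V - W. \<exists>u\<in>V - W. {v, u} \<in> E}"
  obtain a where a: "a \<in> X"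
    using nd unfolding dominating_def independent_set_def X_def by blast
  obtain r where r: "r \<in> W" using W by blast
  have "\<exists>c\<in>X. \<exists>w\<in>W. {w, c} \<in> E"
  proof (rule ccontr)
    assume neg: "\<not> ?thesis"
    have "(a, r) \<in> {(x, y). {x, y} \<in> E}\<^sup>*"
      using G(2) a r W(1) unfolding graph_connected_def X_def by blast
    then have "r \<in> X"
    proof (induction rule: rtrancl_induct)
      case (step y z)
      then have e: "{y, z} \<in> E" "{z, y} \<in> E" by (auto simp: insert_commute)
      then have "z \<notin> W" using neg step(3) by blast
      moreover have "z \<in> V" using edge(2)[OF e(1)] .
      ultimately show ?case using step(3) e by (auto simp: X_def)
    qed (rule a)
    then show False using r by (simp add: X_def)
  qed
  then obtain c d w where cd: "c \<in> V - W" "d \<in> V - W" "{c, d} \<in> E" "w \<in> W" "{w, c} \<in> E"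
    unfolding X_def by blast
  let ?P = "\<lambda>Q. 2 \<le> length Q \<and> distinct Q \<and> set Q \<subseteq> V - W \<and>
    successively (\<lambda>a b. {a, b} \<in> E) Q \<and> (\<exists>w\<in>W. {w, hd Q} \<in> E)"
  have finV: "finite V" using G(1) by (simp add: simple_graph_def)
  have "?P [c, d]" using cd edge(3)[OF cd(3)] by auto
  moreover have "\<forall>Q. ?P Q \<longrightarrow> length Q < Suc (card V)"
  proof (intro allI impI)
    fix Q assume "?P Q"
    then have "length Q = card (set Q)" "set Q \<subseteq> V" by (auto simp: distinct_card)
    then show "length Q < Suc (card V)" using card_mono[OF finV, of "set Q"] by simp
  qed
  ultimately obtain Q where Q: "?P Q" and mx: "\<And>Q'. ?P Q' \<Longrightarrow> length Q' \<le> length Q"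
    using ex_has_greatest_nat[of ?P "[c, d]" length] by blast
  have "u \<in> W \<union> set Q" if u: "{last Q, u} \<in> E" for u
  proof (rule ccontr)
    assume "u \<notin> W \<union> set Q"
    moreover have "Q \<noteq> []" using Q by auto
    ultimately have "?P (Q @ [u])"
      using Q u edge(2)[OF u] by (auto simp: successively_append_iff)
    from mx[OF this] show False by simp
  qed
  with Q show thesis using that by blast
qed

lemma card_le_tree_order:
  assumes "finite V" "tree X D" "X \<subseteq> V" "D \<subseteq> E" "card (leaves X D) \<le> j"
  shows "card X \<le> tree_order V E j"
  unfolding tree_order_def
proof (rule Max_ge)
  have "{card W |W F. is_subgraph W F V E \<and> ended_tree j W F} \<subseteq> card ` Pow V"
    unfolding is_subgraph_def by auto
  then show "finite {card W |W F. is_subgraph W F V E \<and> ended_tree j W F}"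
    by (rule finite_subset) (use assms(1) in simp)
  have "is_tree X D" using assms(2) by (rule tree_is_tree)
  then show "card X \<in> {card W |W F. is_subgraph W F V E \<and> ended_tree j W F}"
    using assms unfolding is_subgraph_def ended_tree_def is_tree_def by blast
qed

theorem theorem3:
  fixes V :: "'a set" and E :: "'a set set" and k :: nat
  assumes "k \<ge> 2"
    and "simple_graph V E"
    and "graph_connected V E"
    and "sigma3 V E \<ge> ereal (real (tree_order V E (k + 1)) - 2 * real k + 4)"
  shows "\<exists>W F. is_subgraph W F V E \<and> ended_tree k W F \<and> dominating V E W"
proof -
  have finV: "finite V" using assms(2) by (simp add: simple_graph_def)
  obtain v where "v \<in> V" using assms(3) unfolding graph_connected_def by blast
  then obtain W F where T: "tree W F" "W \<subseteq> V" "F \<subseteq> E" "card (leaves W F) \<le> k"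
    and largest: "\<And>X D. tree X D \<Longrightarrow> X \<subseteq> V \<Longrightarrow> D \<subseteq> E \<Longrightarrow> card (leaves X D) \<le> k \<Longrightarrow> card X \<le> card W"
    using exists_largest_ended_tree[OF finV, of v E k] by metis
  have tr: "is_tree W F" by (rule tree_is_tree[OF T(1)])
  have "dominating V E W"
  proof (rule ccontr)
    assume nd: "\<not> dominating V E W"
    have "W \<noteq> {}" using tr unfolding is_tree_def graph_connected_def by blast
    then obtain Q where Q: "2 \<le> length Q" "distinct Q" "set Q \<subseteq> V - W" "successively (\<lambda>a b. {a, b} \<in> E) Q"
      "\<exists>w\<in>W. {w, hd Q} \<in> E" and maximal: "\<And>u. {last Q, u} \<in> E \<Longrightarrow> u \<in> W \<union> set Q"
      using exists_maximal_outer_path[OF assms(2,3) T(2) _ nd] by metis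
    interpret largest_ended_tree V E k W F Q
      by unfold_locales (fact assms(2) assms(1) T largest Q)+
    obtain S where S: "S \<subseteq> V" "card S = 3" "independent_set E S"
      and sum: "(\<Sum>v\<in>S. degree E v) + 2 * k \<le> card W + length Q + 3"
      using independent_triple[OF maximal] by blast
    have "card W + length Q \<le> tree_order V E (k + 1)"
      using larger_tree card_le_tree_order[OF finV] by metis
    \<comment> \<open>The strict inequality is the constant 3 from the count against the 4 in the
      hypothesis.\<close>
    with sum have *: "real (\<Sum>v\<in>S. degree E v) < real (tree_order V E (k + 1)) - 2 * real k + 4"
      by linarith
    have "sigma3 V E \<le> ereal (real (\<Sum>v\<in>S. degree E v))"
      unfolding sigma3_def using S by (intro INF_lower) simp
    also have "\<dots> < ereal (real (tree_order V E (k + 1)) - 2 * real k + 4)"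
      using * by (simp only: less_ereal.simps)
    finally show False using assms(4) by simp
  qed
  moreover have "is_subgraph W F V E" "ended_tree k W F"
    using tr T by (auto simp: is_subgraph_def ended_tree_def is_tree_def)
  ultimately show ?thesis by blast
qed

end
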